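(* Let $X,Z\in\mathbb R^{n\times m}$ and $Y=X+Z$. For all $1\le R\le\min\{n,m\}$, write the full SVD of $Y$ as $$Y=\begin{bmatrix}\widehat U_{(R)}&\widehat U_\perp\end{bmatrix}\begin{bmatrix}\widehat\Sigma_{(R)}&\\&\widehat\Sigma_\perp\end{bmatrix}\begin{bmatrix}\widehat V_{(R)}^\top\\\widehat V_\perp^\top\end{bmatrix},$$ where $\widehat U_{(R)}\in\mathbb R^{n\times R}$, $\widehat V_{(R)}\in\mathbb R^{m\times R}$ have as orthonormal columns the leading $R$ left and right singular vectors of $Y$, and $\widehat U_\perp\in\mathbb R^{n\times(n-R)}$, $\widehat V_\perp\in\mathbb R^{m\times(m-R)}$ are their orthonormal complements. Then $$\|\mathcal P_{\widehat U_\perp}X\|_{\mathrm F}\le3\sqrt{\sum_{j=R+1}^{\min\{n,m\}}\sigma_j^2(X)}+2\min\{\sqrt R\,\|Z\|_{\mathrm{op}},\|Z\|_{\mathrm F}\}=3\|X_{(R)}-X\|_{\mathrm F}+2\min\{\sqrt R\,\|Z\|_{\mathrm{op}},\|Z\|_{\mathrm F}\}.$$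
   Context: $\sigma_1(X)\ge\sigma_2(X)\ge\cdots$ are the singular values of $X$; $X_{(R)}$ is the rank-$R$ truncated SVD of $X$; $\|\cdot\|_{\mathrm{op}}$ is the spectral norm and $\|\cdot\|_{\mathrm F}$ the Frobenius norm; $\mathcal P_U=UU^\top$ for a matrix $U$ with orthonormal columns. All matrices are real. *)

theory Defs
  imports Complex_Main "Jordan_Normal_Form.Char_Poly"
begin

definition append_cols :: "'a :: zero mat \<Rightarrow> 'a mat \<Rightarrow> 'a mat" where
  "append_cols A B = four_block_mat A B (0\<^sub>m 0 (dim_col A)) (0\<^sub>m 0 (dim_col B))"

definition vec_norm2 :: "real vec \<Rightarrow> real" where
  "vec_norm2 v = sqrt (v \<bullet> v)"

definition frob_norm :: "real mat \<Rightarrow> real" where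
  "frob_norm A = sqrt (\<Sum>i<dim_row A. \<Sum>j<dim_col A. (A $$ (i, j))\<^sup>2)"

definition op_norm :: "real mat \<Rightarrow> real" where
  "op_norm A = Sup {vec_norm2 (A *\<^sub>v v) | v. v \<in> carrier_vec (dim_col A) \<and> vec_norm2 v \<le> 1}"

(* The square root of the j-th largest eigenvalue of A^T A, counted with multiplicity;
   j starts at 1, and only 1 <= j <= min (dim_row A) (dim_col A) is meaningful. *)
definition singular_value :: "nat \<Rightarrow> real mat \<Rightarrow> real" where
  "singular_value j A =
     sqrt (rev (sorted_list_of_multiset (proots (char_poly (A\<^sup>T * A)))) ! (j - 1))"

definition orthonormal_cols :: "real mat \<Rightarrow> bool" where
  "orthonormal_cols U \<longleftrightarrow> U\<^sup>T * U = 1\<^sub>m (dim_col U)"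

definition col_proj :: "real mat \<Rightarrow> real mat" where
  "col_proj U = U * U\<^sup>T"

definition is_full_svd :: "real mat \<Rightarrow> real mat \<Rightarrow> real mat \<Rightarrow> real mat \<Rightarrow> bool" where
  "is_full_svd A U S V \<longleftrightarrow>
     U \<in> carrier_mat (dim_row A) (dim_row A) \<and> orthonormal_cols U \<and>
     V \<in> carrier_mat (dim_col A) (dim_col A) \<and> orthonormal_cols V \<and>
     S \<in> carrier_mat (dim_row A) (dim_col A) \<and> diagonal_mat S \<and>
     (\<forall>i < min (dim_row A) (dim_col A). 0 \<le> S $$ (i, i)) \<and>
     (\<forall>i j. i \<le> j \<longrightarrow> j < min (dim_row A) (dim_col A) \<longrightarrow> S $$ (j, j) \<le> S $$ (i, i)) \<and>
     A = U * S * V\<^sup>T"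

(* A full SVD of A partitioned after its R leading singular triples. The trailing blocks may
   have no rows or no columns; Sp is rectangular in general. *)
definition is_block_svd ::
  "nat \<Rightarrow> real mat \<Rightarrow> real mat \<Rightarrow> real mat \<Rightarrow> real mat \<Rightarrow> real mat \<Rightarrow> real mat \<Rightarrow> real mat \<Rightarrow> bool"
where
  "is_block_svd R A U Up S Sp V Vp \<longleftrightarrow>
     U \<in> carrier_mat (dim_row A) R \<and> Up \<in> carrier_mat (dim_row A) (dim_row A - R) \<and>
     S \<in> carrier_mat R R \<and> Sp \<in> carrier_mat (dim_row A - R) (dim_col A - R) \<and>
     V \<in> carrier_mat (dim_col A) R \<and> Vp \<in> carrier_mat (dim_col A) (dim_col A - R) \<and>
     is_full_svd A (append_cols U Up)
       (four_block_mat S (0\<^sub>m R (dim_col A - R)) (0\<^sub>m (dim_row A - R) R) Sp)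
       (append_cols V Vp)"

(* A relation, because the truncation depends on the chosen SVD when the R-th and (R+1)-st
   singular values coincide. *)
definition is_truncated_svd :: "nat \<Rightarrow> real mat \<Rightarrow> real mat \<Rightarrow> bool" where
  "is_truncated_svd R A B \<longleftrightarrow>
     (\<exists>U Up S Sp V Vp. is_block_svd R A U Up S Sp V Vp \<and> B = U * S * V\<^sup>T)"

end

theory Submission
  imports Defs "HOL-Analysis.L2_Norm"
begin

(*
  Let Q diagonalise X^T X and let Uh, Sh, Vh be the full SVD factors of Y = X + Z. In the coordinates
  a = Uh^T X Q, c = Uh^T Z Q, k = Vh^T Q one has a + c = Sh k with k orthogonal, and the
  quantity to bound is the Frobenius norm of the rows R, R+1, ... of a (indices start at 0). Its
  columns j >= R contribute at most the tail e of the singular values of X. On the columns j < R, a is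
  Sh k - c; the part c is at most min (sqrt R * op_norm Z) (frob_norm Z), and the part Sh k has
  squared norm sum_i s_i^2 w_i over i >= R, where w_i, the sum of k_ij^2 over j < R, satisfies
  0 <= w_i <= 1 and sum_i w_i = R. Weyl's inequality
  s_i <= op_norm Z + sigma_i(X) bounds its norm by sqrt R * op_norm Z + e; an Eckart--Young comparison
  with the columns j >= R of a + c bounds it by frob_norm Z + e. *)

text \<open>No gap between singular values is available, so the singular subspaces of
  \<open>X\<close> and \<open>Y\<close> cannot be compared directly. The mixed coordinates avoid
  this: the left rotation by \<open>Uh\<close> turns the projection into a choice of rows, the right
  rotation by \<open>Q\<close> turns the tail of \<open>X\<close> into a choice of columns, and the
  two choices meet only in the weights \<open>w\<close>. From \<open>X\<close> only an eigenbasis of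
  X^T X is used, so no SVD of \<open>X\<close> has to be constructed for the inequality. Write mu
  for the minimum in the claim. The block of rows i >= R and columns j < R costs e + mu for
  \<open>Sh k\<close> and another mu for removing \<open>c\<close>; the columns j >= R of
  \<open>a\<close> cost one more e. This gives 2 e + 2 mu, which is stronger than the claimed 3 e +
  2 mu.\<close>

section \<open>Orthogonal families and homogeneous linear systems\<close>

text \<open>Pythagoras for a linear combination of orthogonal columns: after expanding the square,
  only the terms j = j' survive. With \<open>d\<close> constantly 1 it says that orthonormal columns
  act isometrically.\<close>

lemma sum_squares_orthogonal:
  fixes f :: "nat \<Rightarrow> nat \<Rightarrow> real"
  assumes "\<And>j j'. j < m \<Longrightarrow> j' < m \<Longrightarrow> (\<Sum>i<n. f i j * f i j') = (if j = j' then d j else 0)"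
  shows "(\<Sum>i<n. (\<Sum>j<m. f i j * x j)\<^sup>2) = (\<Sum>j<m. d j * (x j)\<^sup>2)"
proof -
  have "(\<Sum>i<n. (\<Sum>j<m. f i j * x j)\<^sup>2) = (\<Sum>i<n. \<Sum>j<m. \<Sum>j'<m. f i j * f i j' * (x j * x j'))"
    by (simp add: power2_eq_square sum_product mult_ac)
  also have "\<dots> = (\<Sum>j<m. \<Sum>i<n. \<Sum>j'<m. f i j * f i j' * (x j * x j'))"
    by (rule sum.swap)
  also have "\<dots> = (\<Sum>j<m. \<Sum>j'<m. \<Sum>i<n. f i j * f i j' * (x j * x j'))"
    by (intro sum.cong refl sum.swap)
  also have "\<dots> = (\<Sum>j<m. \<Sum>j'<m. (if j = j' then d j else 0) * (x j * x j'))"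
    using assms by (simp flip: sum_distrib_right)
  also have "\<dots> = (\<Sum>j<m. d j * (x j)\<^sup>2)"
    by (simp add: if_distrib[of "\<lambda>x. x * _"] sum.delta power2_eq_square cong: if_cong)
  finally show ?thesis .
qed

text \<open>A system of \<open>k\<close> equations in \<open>k + 1\<close> unknowns, padded by a
  zero row to a square matrix of determinant 0. It supplies every dimension count below.\<close>

lemma underdetermined_system:
  fixes M :: "nat \<Rightarrow> nat \<Rightarrow> real"
  obtains c where "\<exists>j\<le>k. c j \<noteq> 0" "\<And>i. i < k \<Longrightarrow> (\<Sum>j\<le>k. M i j * c j) = 0"
proof -
  define A where "A = mat (Suc k) (Suc k) (\<lambda>(i, j). if i < k then M i j else 0)"
  have A: "A \<in> carrier_mat (Suc k) (Suc k)" by (simp add: A_def)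
  have "A = mat\<^sub>r (Suc k) (Suc k) (\<lambda>i. if i = k then 0\<^sub>v (Suc k) else row A i)"
    by (rule eq_matI) (auto simp: A_def)
  hence "det A = 0"
    using det_row_0[of k "Suc k" "\<lambda>i. row A i"] A by auto
  then obtain v where v: "v \<in> carrier_vec (Suc k)" "v \<noteq> 0\<^sub>v (Suc k)" "A *\<^sub>v v = 0\<^sub>v (Suc k)"
    using det_0_iff_vec_prod_zero_field[OF A] by auto
  have "(\<Sum>j\<le>k. M i j * v $ j) = 0" if "i < k" for i
  proof -
    have "(A *\<^sub>v v) $ i = 0" using v(3) that by simp
    thus ?thesis using that v(1)
      by (simp add: A_def scalar_prod_def atLeast0LessThan flip: lessThan_Suc_atMost)
  qed
  moreover have "\<exists>j\<le>k. v $ j \<noteq> 0" using v by (auto simp: less_Suc_eq_le)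
  ultimately show ?thesis using that by blast
qed

section \<open>Spectral theorem for real symmetric matrices\<close>

text \<open>The polynomial splits over the complex numbers; symmetry makes each root real, and the
  factorisation descends because the embedding of the reals is injective on polynomials.\<close>

lemma symmetric_char_poly_splits:
  fixes A :: "real mat"
  assumes A: "A \<in> carrier_mat n n" and sym: "A\<^sup>T = A"
  obtains es where "char_poly A = (\<Prod>e\<leftarrow>es. [:- e, 1:])" "length es = n" "sorted (rev es)"
proof -
  interpret cr: inj_idom_hom complex_of_real by standard auto
  interpret cp: map_poly_inj_idom_hom complex_of_real ..
  define B where "B = map_mat complex_of_real A"
  have B: "B \<in> carrier_mat n n" using A by (simp add: B_def)
  from char_poly_factorized[OF B] obtain as where
    as: "char_poly B = (\<Prod>a\<leftarrow>as. [:- a, 1:])" "length as = n" by auto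
  have real: "a \<in> \<real>" if "a \<in> set as" for a
  proof -
    have "poly (char_poly B) a = 0"
      using that by (auto simp: as(1) poly_prod_list prod_list_zero_iff intro!: image_eqI)
    then obtain v where v: "v \<in> carrier_vec n" "v \<noteq> 0\<^sub>v n" "B *\<^sub>v v = a \<cdot>\<^sub>v v"
      using eigenvalue_root_char_poly[OF B] B unfolding eigenvalue_def eigenvector_def by auto
    have cv: "conjugate v \<in> carrier_vec n" using v(1) by simp
    have BT: "B\<^sup>T = B" using sym by (metis B_def map_mat_transpose)
    have conj: "B *\<^sub>v conjugate v = cnj a \<cdot>\<^sub>v conjugate v"
    proof (rule eq_vecI)
      fix i assume i: "i < dim_vec (cnj a \<cdot>\<^sub>v conjugate v)"
      hence "(B *\<^sub>v conjugate v) $ i = cnj ((B *\<^sub>v v) $ i)"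
        using v(1) B A by (auto simp: scalar_prod_def B_def)
      thus "(B *\<^sub>v conjugate v) $ i = (cnj a \<cdot>\<^sub>v conjugate v) $ i" using i v by simp
    qed (use B v in auto)
    \<comment> \<open>The pairing of \<open>B v\<close> with the conjugate of \<open>v\<close> is
      evaluated in two ways; the self-pairing of \<open>v\<close> is nonzero and cancels, leaving a
      = cnj a.\<close>
    have "a * (v \<bullet> conjugate v) = (B *\<^sub>v v) \<bullet> conjugate v" using v cv by simp
    also have "\<dots> = v \<bullet> (B *\<^sub>v conjugate v)"
      using transpose_vec_mult_scalar[OF B cv v(1)] BT B v cv
      by (metis comm_scalar_prod mult_mat_vec_carrier)
    also have "\<dots> = cnj a * (v \<bullet> conjugate v)" using conj v cv by simp
    finally have "a = cnj a" using v(1,2) conjugate_square_eq_0_vec[OF v(1)] by auto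
    thus ?thesis by (simp add: Reals_cnj_iff)
  qed
  define es where "es = rev (sort (map Re as))"
  have "map complex_of_real (map Re as) = as" using real by (auto intro!: map_idI)
  moreover have "map_poly complex_of_real (\<Prod>e\<leftarrow>map Re as. [:- e, 1:])
      = (\<Prod>e\<leftarrow>map complex_of_real (map Re as). [:- e, 1:])"
    by (simp add: cp.hom_prod_list o_def)
  ultimately have "map_poly complex_of_real (char_poly A)
      = map_poly complex_of_real (\<Prod>e\<leftarrow>map Re as. [:- e, 1:])"
    using of_real_hom.char_poly_hom[OF A, where ?'a = complex] as(1) by (simp add: B_def)
  hence "char_poly A = (\<Prod>e\<leftarrow>map Re as. [:- e, 1:])" by (rule cp.injectivity)
  \<comment> \<open>Sorting only permutes the linear factors, so the product is compared through
    multisets.\<close>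
  also have "\<dots> = (\<Prod>e\<leftarrow>es. [:- e, 1:])"
    unfolding prod_mset_prod_list[symmetric] mset_map es_def by simp
  finally show ?thesis using as(2) that[of es] by (simp add: es_def)
qed

text \<open>Completes a given direction to an orthonormal basis, as the deflation step of the
  diagonalisation requires.\<close>

lemma orthogonal_matrix_with_first_col:
  fixes v :: "real vec"
  assumes v: "v \<in> carrier_vec n" "v \<noteq> 0\<^sub>v n"
  obtains H c where "H \<in> carrier_mat n n" "H\<^sup>T * H = 1\<^sub>m n" "col H 0 = c \<cdot>\<^sub>v v"
proof -
  obtain i0 where "i0 < n" "v $ i0 \<noteq> 0" using v by (metis carrier_vecD eq_vecI index_zero_vec)
  hence n: "0 < n" by auto
  define q where "q = (\<Sum>i<n. (v $ i)\<^sup>2)"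
  have "0 < (v $ i0)\<^sup>2" using \<open>v $ i0 \<noteq> 0\<close> by simp
  also have "\<dots> \<le> q" unfolding q_def using \<open>i0 < n\<close> by (intro member_le_sum) auto
  finally have q: "q > 0" .
  define c where "c = 1 / sqrt q"
  define u where "u i = c * v $ i" for i
  have "(\<Sum>i<n. (u i)\<^sup>2) = c\<^sup>2 * q"
    by (simp add: u_def q_def power_mult_distrib sum_distrib_left)
  also have "\<dots> = 1" using q by (simp add: c_def power_divide)
  finally have u1: "(\<Sum>i<n. (u i)\<^sup>2) = 1" .
  define w where "w i = u i - (if i = 0 then 1 else 0)" for i
  have uw: "u i = w i + (if i = 0 then 1 else 0)" for i by (simp add: w_def)
  have ww: "(\<Sum>i<n. (w i)\<^sup>2) = - 2 * w 0"
  proof -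
    have "(u i)\<^sup>2 = (w i)\<^sup>2 + (if i = 0 then 2 * w 0 + 1 else 0)" for i
      by (simp add: uw power2_eq_square algebra_simps)
    with u1 n show ?thesis by (simp add: sum.distrib)
  qed
  \<comment> \<open>The reflection coefficient is 2 / |w|^2, and |w|^2 = - 2 * w 0 because
    \<open>u\<close> is a unit vector. If \<open>w 0\<close> is 0, then \<open>w\<close> vanishes,
    the direction is already the first axis, and t = 0 makes the reflection the identity.\<close>
  define t where "t = (if w 0 = 0 then 0 else - 1 / w 0)"
  have tww: "t * t * (\<Sum>l<n. (w l)\<^sup>2) = 2 * t"
  proof (cases "w 0 = 0")
    case False
    hence "t * w 0 = - 1" by (simp add: t_def)
    hence "t * (t * w 0) = - t" by simp
    thus ?thesis by (simp add: ww)
  qed (simp add: t_def)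
  have tw: "t * w 0 * w i = - w i" if "i < n" for i
  proof (cases "w 0 = 0")
    case True
    with ww have "\<forall>i<n. w i = 0" by (simp add: sum_nonneg_eq_0_iff)
    thus ?thesis using that by simp
  qed (simp add: t_def)
  \<comment> \<open>the Householder reflection exchanging the normalised vector and the first unit vector\<close>
  define H where "H = mat n n (\<lambda>(i, j). (if i = j then 1 else 0) - t * w i * w j)"
  have H: "H \<in> carrier_mat n n" by (simp add: H_def)
  have "H\<^sup>T * H = 1\<^sub>m n"
  proof (rule eq_matI)
    fix i j assume "i < dim_row (1\<^sub>m n :: real mat)" "j < dim_col (1\<^sub>m n :: real mat)"
    hence ij: "i < n" "j < n" by auto
    have "(H\<^sup>T * H) $$ (i, j) =
        (\<Sum>l<n. ((if l = i then 1 else 0) - t * w l * w i) * ((if l = j then 1 else 0) - t * w l * w j))"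
      using ij by (simp add: H_def scalar_prod_def atLeast0LessThan)
    also have "\<dots> = (\<Sum>l<n. (if l = i then (if i = j then 1 else 0) - t * w i * w j else 0)
        - (if l = j then t * w i * w j else 0) + t * t * (w l)\<^sup>2 * w i * w j)"
      by (intro sum.cong) (auto simp: algebra_simps power2_eq_square)
    also have "\<dots> = (if i = j then 1 else 0) - 2 * t * w i * w j + (t * t * (\<Sum>l<n. (w l)\<^sup>2)) * w i * w j"
      using ij by (simp add: sum.distrib sum_subtractf sum_distrib_left sum_distrib_right)
    also have "\<dots> = 1\<^sub>m n $$ (i, j)" unfolding tww using ij by simp
    finally show "(H\<^sup>T * H) $$ (i, j) = 1\<^sub>m n $$ (i, j)" .
  qed (use H in auto)
  moreover have "col H 0 = c \<cdot>\<^sub>v v"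
  proof (rule eq_vecI)
    fix i assume "i < dim_vec (c \<cdot>\<^sub>v v)"
    hence i: "i < n" using v by simp
    have "col H 0 $ i = (if i = 0 then 1 else 0) - t * w 0 * w i"
      using i n by (simp add: H_def mult_ac)
    thus "col H 0 $ i = (c \<cdot>\<^sub>v v) $ i" using tw[OF i] uw[of i] i v by (simp add: u_def)
  qed (use H v in auto)
  ultimately show ?thesis using that H by blast
qed

text \<open>Deflation: an eigenvector for the head of the list is rotated onto the first axis, and
  the remaining block has the remaining linear factors as its characteristic polynomial. Since the
  list is fixed beforehand, the eigenvalues appear on the diagonal in the prescribed order, and
  sorting the list suffices to sort the diagonal.\<close>

lemma symmetric_diagonalization_aux:
  fixes A :: "real mat"
  assumes "A \<in> carrier_mat n n" "A\<^sup>T = A" "char_poly A = (\<Prod>e\<leftarrow>es. [:- e, 1:])" "length es = n"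
  shows "\<exists>Q \<in> carrier_mat n n. Q\<^sup>T * Q = 1\<^sub>m n \<and>
    Q\<^sup>T * A * Q = mat n n (\<lambda>(i, j). if i = j then es ! i else 0)"
  using assms
proof (induction es arbitrary: A n)
  case Nil
  hence "(1\<^sub>m n)\<^sup>T * A * 1\<^sub>m n = mat n n (\<lambda>(i, j). if i = j then [] ! i else 0)"
    by (intro eq_matI) auto
  thus ?case using Nil by (intro bexI[of _ "1\<^sub>m n"]) auto
next
  case (Cons e es)
  define n' where "n' = length es"
  have n: "n = Suc n'" using Cons.prems by (simp add: n'_def)
  note A = Cons.prems(1)
  have "poly (char_poly A) e = 0" using Cons.prems(3) by simp
  then obtain v where v: "v \<in> carrier_vec n" "v \<noteq> 0\<^sub>v n" "A *\<^sub>v v = e \<cdot>\<^sub>v v"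
    using eigenvalue_root_char_poly[OF A] A unfolding eigenvalue_def eigenvector_def by auto
  obtain H c where H: "H \<in> carrier_mat n n" and HH: "H\<^sup>T * H = 1\<^sub>m n" and col: "col H 0 = c \<cdot>\<^sub>v v"
    using orthogonal_matrix_with_first_col[OF v(1,2)] .
  have HT: "H\<^sup>T \<in> carrier_mat n n" using H by simp
  have HH': "H * H\<^sup>T = 1\<^sub>m n" using mat_mult_left_right_inverse[OF HT H HH] .
  define M where "M = H\<^sup>T * A * H"
  have M: "M \<in> carrier_mat n n" using H A by (simp add: M_def)
  have symM: "M\<^sup>T = M"
    unfolding M_def using H A HT Cons.prems(2)
    by (simp add: transpose_mult[of _ n n _ n] assoc_mult_mat[of _ n n _ n _ n])
  have cpM: "char_poly M = char_poly A"
    by (rule char_poly_similar, unfold similar_mat_def, rule exI, rule exI,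
      rule similar_mat_witI[OF HH HH' _ M A HT H]) (simp add: M_def)
  \<comment> \<open>The first column of \<open>H\<close> is a multiple of the eigenvector
    \<open>v\<close>, so \<open>A\<close> scales it by \<open>e\<close>, and the rows of
    \<open>H^T\<close> pick out its orthonormality relations.\<close>
  have M0: "M $$ (i, 0) = (if i = 0 then e else 0)" if i: "i < n" for i
  proof -
    have "M $$ (i, 0) = row H\<^sup>T i \<bullet> col (A * H) 0"
      unfolding M_def using i n H A HT by (simp add: assoc_mult_mat[of _ n n _ n _ n])
    also have "col (A * H) 0 = A *\<^sub>v col H 0"
      by (rule eq_vecI) (use n H A in auto)
    also have "\<dots> = e \<cdot>\<^sub>v col H 0"
      using v A by (simp add: col mult_mat_vec smult_smult_assoc mult.commute)
    also have "row H\<^sup>T i \<bullet> \<dots> = e * (H\<^sup>T * H) $$ (i, 0)"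
      using i n H by simp
    finally show ?thesis using HH i n by simp
  qed
  \<comment> \<open>Symmetry clears the first row as well, which makes \<open>M\<close> block
    diagonal.\<close>
  have M0': "M $$ (0, i) = (if i = 0 then e else 0)" if i: "i < n" for i
  proof -
    have "M $$ (0, i) = M\<^sup>T $$ (i, 0)" using M i n by simp
    thus ?thesis using M0[OF i] by (simp add: symM)
  qed
  define A' where "A' = mat n' n' (\<lambda>(i, j). M $$ (Suc i, Suc j))"
  have A': "A' \<in> carrier_mat n' n'" by (simp add: A'_def)
  define E where "E = mat 1 1 (\<lambda>_. e)"
  have E: "E \<in> carrier_mat 1 1" by (simp add: E_def)
  have blockM: "M = four_block_mat E (0\<^sub>m 1 n') (0\<^sub>m n' 1) A'"
    by (rule eq_matI) (use M M0 M0' n in \<open>auto simp: A'_def E_def\<close>)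
  have "A'\<^sup>T = A'"
  proof (rule eq_matI)
    fix i j assume "i < dim_row A'" "j < dim_col A'"
    thus "A'\<^sup>T $$ (i, j) = A' $$ (i, j)"
      using arg_cong[OF symM, of "\<lambda>B. B $$ (Suc i, Suc j)"] M n by (simp add: A'_def)
  qed (simp_all add: A'_def)
  moreover have "char_poly A' = (\<Prod>e\<leftarrow>es. [:- e, 1:])"
  proof -
    have "char_poly E = [:- e, 1:]"
      by (subst char_poly_upper_triangular[OF E]) (auto simp: E_def diag_mat_def)
    hence "char_poly M = [:- e, 1:] * char_poly A'"
      unfolding blockM by (subst char_poly_four_block_zeros_col[OF E _ A']) auto
    hence "[:- e, 1:] * char_poly A' = [:- e, 1:] * (\<Prod>e\<leftarrow>es. [:- e, 1:])"
      using cpM Cons.prems(3) by simp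
    thus ?thesis by (subst (asm) mult_left_cancel) auto
  qed
  ultimately obtain Q where Q: "Q \<in> carrier_mat n' n'" "Q\<^sup>T * Q = 1\<^sub>m n'"
    "Q\<^sup>T * A' * Q = mat n' n' (\<lambda>(i, j). if i = j then es ! i else 0)"
    using Cons.IH[OF A'] n'_def by blast
  define F where "F = four_block_mat (1\<^sub>m 1) (0\<^sub>m 1 n') (0\<^sub>m n' 1) Q"
  have F: "F \<in> carrier_mat n n" by (intro carrier_matI) (use Q n in \<open>auto simp: F_def\<close>)
  have FT: "F\<^sup>T = four_block_mat (1\<^sub>m 1) (0\<^sub>m 1 n') (0\<^sub>m n' 1) Q\<^sup>T"
    unfolding F_def by (subst transpose_four_block_mat[of _ 1 1 _ n' _ n']) (use Q in auto)
  have FF: "F\<^sup>T * F = 1\<^sub>m n"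
    unfolding FT unfolding F_def
    by (subst mult_four_block_mat[of _ 1 1 _ n' _ n' _ _ 1 _ n']) (use Q n in auto)
  have FMF: "F\<^sup>T * M * F = mat n n (\<lambda>(i, j). if i = j then (e # es) ! i else 0)"
  proof -
    have "F\<^sup>T * M = four_block_mat E (0\<^sub>m 1 n') (0\<^sub>m n' 1) (Q\<^sup>T * A')"
      unfolding FT blockM
      by (subst mult_four_block_mat[of _ 1 1 _ n' _ n' _ _ 1 _ n']) (use Q E A' in auto)
    also have "\<dots> * F = four_block_mat E (0\<^sub>m 1 n') (0\<^sub>m n' 1) (Q\<^sup>T * A' * Q)"
      unfolding F_def
      by (subst mult_four_block_mat[of _ 1 1 _ n' _ n' _ _ 1 _ n']) (use Q E A' in auto)
    also have "\<dots> = mat n n (\<lambda>(i, j). if i = j then (e # es) ! i else 0)"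
      unfolding Q(3) by (rule eq_matI) (auto simp: E_def n nth_Cons')
    finally show ?thesis .
  qed
  have FTc: "F\<^sup>T \<in> carrier_mat n n" using F by simp
  have "(H * F)\<^sup>T * (H * F) = F\<^sup>T * (H\<^sup>T * H) * F"
    using H F HT FTc by (simp add: transpose_mult[of _ n n _ n] assoc_mult_mat[of _ n n _ n _ n])
  moreover have "(H * F)\<^sup>T * A * (H * F) = F\<^sup>T * M * F"
    using H F HT FTc A
    by (simp add: M_def transpose_mult[of _ n n _ n] assoc_mult_mat[of _ n n _ n _ n])
  ultimately show ?case using H F FF FMF HH FTc by (intro bexI[of _ "H * F"]) auto
qed

lemma symmetric_diagonalization:
  fixes A :: "real mat"
  assumes A: "A \<in> carrier_mat n n" and sym: "A\<^sup>T = A"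
  obtains Q d where "Q \<in> carrier_mat n n" "orthonormal_cols Q"
    "Q\<^sup>T * A * Q = mat n n (\<lambda>(i, j). if i = j then d i else 0)"
    "\<And>i j. i \<le> j \<Longrightarrow> j < n \<Longrightarrow> d j \<le> d i"
proof -
  obtain es where es: "char_poly A = (\<Prod>e\<leftarrow>es. [:- e, 1:])" "length es = n" "sorted (rev es)"
    using symmetric_char_poly_splits[OF A sym] .
  from symmetric_diagonalization_aux[OF A sym es(1,2)] obtain Q where
    "Q \<in> carrier_mat n n" "Q\<^sup>T * Q = 1\<^sub>m n"
    "Q\<^sup>T * A * Q = mat n n (\<lambda>(i, j). if i = j then es ! i else 0)" by blast
  moreover have "es ! j \<le> es ! i" if "i \<le> j" "j < n" for i j
    using es(2,3) that by (simp add: sorted_rev_nth_mono)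
  ultimately show ?thesis using that[of Q "\<lambda>i. es ! i"] by (simp add: orthonormal_cols_def)
qed

section \<open>Singular values read off a diagonalisation\<close>

text \<open>Similar matrices share their characteristic polynomial, so its multiset of roots is that
  of the diagonal; a decreasing \<open>d\<close> is already the reversed sorted list. The shift
  \<open>j - 1\<close> passes from singular values counted from 1 to indices from 0.\<close>

lemma singular_value_of_diagonalization:
  assumes X: "X \<in> carrier_mat n m" and Q: "Q \<in> carrier_mat m m" "orthonormal_cols Q"
    and diag: "Q\<^sup>T * (X\<^sup>T * X) * Q = mat m m (\<lambda>(i, j). if i = j then d i else 0)"
    and dec: "\<And>i j. i \<le> j \<Longrightarrow> j < m \<Longrightarrow> d j \<le> d i"
    and j: "1 \<le> j" "j \<le> m"
  shows "singular_value j X = sqrt (d (j - 1))"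
proof -
  define D where "D = mat m m (\<lambda>(i, j). if i = j then d i else 0)"
  have D: "D \<in> carrier_mat m m" by (simp add: D_def)
  have XX: "X\<^sup>T * X \<in> carrier_mat m m" using X by simp
  have QQ: "Q\<^sup>T * Q = 1\<^sub>m m" using Q by (simp add: orthonormal_cols_def)
  have QQ': "Q * Q\<^sup>T = 1\<^sub>m m"
    using mat_mult_left_right_inverse[OF _ Q(1) QQ] Q by auto
  have "similar_mat D (X\<^sup>T * X)"
    unfolding similar_mat_def
    by (rule exI, rule exI, rule similar_mat_witI[OF QQ QQ' _ D XX])
      (use diag Q in \<open>auto simp: D_def\<close>)
  hence "char_poly (X\<^sup>T * X) = char_poly D" by (metis char_poly_similar)
  also have "\<dots> = (\<Prod>a\<leftarrow>diag_mat D. [:- a, 1:])"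
    by (rule char_poly_upper_triangular[OF D]) (auto simp: D_def upper_triangular_def)
  also have "diag_mat D = map d [0..<m]" by (auto simp: diag_mat_def D_def)
  finally have "char_poly (X\<^sup>T * X) = (\<Prod>a\<leftarrow>map d [0..<m]. [:- a, 1:])" .
  moreover have "proots (\<Prod>a\<leftarrow>xs. [:- a, 1:]) = mset xs" for xs :: "real list"
  proof (induction xs)
    case (Cons a xs)
    have "(\<Prod>a\<leftarrow>xs. [:- a, 1:]) \<noteq> 0" by (auto simp: prod_list_zero_iff)
    hence "proots ([:- a, 1:] * (\<Prod>a\<leftarrow>xs. [:- a, 1:])) = {#a#} + mset xs"
      by (subst proots_mult) (simp_all add: Cons.IH)
    thus ?case by simp
  qed simp
  ultimately have "proots (char_poly (X\<^sup>T * X)) = mset (map d [0..<m])" by metis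
  moreover have "rev (sorted_list_of_multiset (mset (map d [0..<m]))) = map d [0..<m]"
  proof -
    have "sorted (rev (map d [0..<m]))"
      using dec by (auto simp: sorted_iff_nth_mono rev_nth)
    hence "sort (map d [0..<m]) = rev (map d [0..<m])" by (intro properties_for_sort) auto
    thus ?thesis by (metis rev_rev_ident sorted_list_of_multiset_mset)
  qed
  ultimately show ?thesis using j by (simp add: singular_value_def)
qed

section \<open>The inequality for arrays of real numbers\<close>

text \<open>The min-max argument with an explicit test vector \<open>v\<close>: it lies in the span
  of rows 0 to \<open>p\<close> of \<open>k\<close>, where a + c stretches by at least
  \<open>s p\<close>, and its coordinates below \<open>p\<close> vanish, so \<open>a\<close>
  stretches it by at most sqrt (d p). The operator bound \<open>b\<close> on \<open>c\<close>
  accounts for the difference.\<close>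

lemma weyl_inequality_coordinates:
  fixes a c k :: "nat \<Rightarrow> nat \<Rightarrow> real" and s d :: "nat \<Rightarrow> real"
  assumes A: "\<And>j j'. j < m \<Longrightarrow> j' < m \<Longrightarrow> (\<Sum>i<n. a i j * a i j') = (if j = j' then d j else 0)"
    and K: "\<And>i i'. i < m \<Longrightarrow> i' < m \<Longrightarrow> (\<Sum>l<m. k i l * k i' l) = (if i = i' then 1 else 0)"
    and D: "\<And>i j. i < n \<Longrightarrow> j < m \<Longrightarrow> a i j + c i j = (if i < m then s i * k i j else 0)"
    and s: "\<And>i j. i \<le> j \<Longrightarrow> j < min n m \<Longrightarrow> s j \<le> s i" "\<And>i. i < min n m \<Longrightarrow> 0 \<le> s i"
    and d: "\<And>i j. i \<le> j \<Longrightarrow> j < m \<Longrightarrow> d j \<le> d i"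
    and b: "\<And>v. L2_set (\<lambda>i. \<Sum>j<m. c i j * v j) {..<n} \<le> b * L2_set v {..<m}"
    and p: "p < min n m"
  shows "s p \<le> b + sqrt (d p)"
proof -
  \<comment> \<open>There are \<open>p + 1\<close> rows to combine and only \<open>p\<close>
    coordinates to annihilate.\<close>
  obtain x where x: "\<exists>j\<le>p. x j \<noteq> 0" "\<And>i. i < p \<Longrightarrow> (\<Sum>j\<le>p. k j i * x j) = 0"
    using underdetermined_system[of p "\<lambda>i j. k j i"] by blast
  define y where "y j = (if j \<le> p then x j else 0)" for j
  define v where "v i = (\<Sum>j<m. k j i * y j)" for i
  have v0: "v i = 0" if "i < p" for i
  proof -
    have "v i = (\<Sum>j\<le>p. k j i * y j)"
      unfolding v_def by (rule sum.mono_neutral_right) (use p in \<open>auto simp: y_def\<close>)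
    thus ?thesis using x(2)[OF that] by (simp add: y_def)
  qed
  have norm_v: "L2_set v {..<m} = L2_set y {..<m}"
    using sum_squares_orthogonal[where f = "\<lambda>i j. k j i" and d = "\<lambda>_. 1" and n = m and m = m and x = y] K by (simp add: L2_set_def v_def)
  have pos: "L2_set y {..<m} > 0"
  proof -
    have "L2_set y {..<m} \<noteq> 0" using x(1) p by (auto simp: L2_set_eq_0_iff y_def)
    thus ?thesis by (simp add: order_less_le)
  qed
  \<comment> \<open>Row orthonormality recovers the coefficients \<open>y\<close> from
    \<open>v\<close>, so a + c acts on \<open>v\<close> by scaling the entries of
    \<open>y\<close>.\<close>
  have Kv: "(\<Sum>l<m. k i l * v l) = y i" if "i < m" for i
  proof -
    have "(\<Sum>l<m. k i l * v l) = (\<Sum>l<m. \<Sum>j<m. k i l * k j l * y j)"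
      by (simp add: v_def sum_distrib_left mult_ac)
    also have "\<dots> = (\<Sum>j<m. \<Sum>l<m. k i l * k j l * y j)" by (rule sum.swap)
    also have "\<dots> = (\<Sum>j<m. (if i = j then 1 else 0) * y j)"
      using K that by (simp flip: sum_distrib_right)
    also have "\<dots> = y i" using that by (simp add: if_distrib[of "\<lambda>x. x * _"] cong: if_cong)
    finally show ?thesis .
  qed
  have Dv: "(\<Sum>j<m. a i j * v j) + (\<Sum>j<m. c i j * v j) = (if i < m then s i * y i else 0)"
    if "i < n" for i
  proof -
    have "(\<Sum>j<m. a i j * v j) + (\<Sum>j<m. c i j * v j) = (\<Sum>j<m. (a i j + c i j) * v j)"
      by (simp add: sum.distrib distrib_right)
    also have "\<dots> = (\<Sum>j<m. (if i < m then s i * (k i j * v j) else 0))"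
      using D that by (intro sum.cong) auto
    finally show ?thesis using Kv by (simp flip: sum_distrib_left)
  qed
  have "s p * L2_set y {..<m} = L2_set (\<lambda>i. s p * y i) {..<m}"
    using s(2)[OF p] by (rule L2_set_right_distrib)
  also have "\<dots> = L2_set (\<lambda>i. s p * y i) {..p}"
    unfolding L2_set_def using p
    by (intro arg_cong[of _ _ sqrt] sum.mono_neutral_right) (auto simp: y_def)
  also have "\<dots> \<le> L2_set (\<lambda>i. if i < m then s i * y i else 0) {..p}"
    unfolding L2_set_def
  proof (intro real_sqrt_le_mono sum_mono)
    fix i assume "i \<in> {..p}"
    hence "(s p)\<^sup>2 \<le> (s i)\<^sup>2" "i < m" using s p by (auto intro!: power_mono)
    thus "(s p * y i)\<^sup>2 \<le> (if i < m then s i * y i else 0)\<^sup>2"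
      by (simp add: power_mult_distrib mult_right_mono)
  qed
  also have "\<dots> \<le> L2_set (\<lambda>i. if i < m then s i * y i else 0) {..<n}"
    unfolding L2_set_def using p by (intro real_sqrt_le_mono sum_mono2) auto
  also have "\<dots> = L2_set (\<lambda>i. (\<Sum>j<m. a i j * v j) + (\<Sum>j<m. c i j * v j)) {..<n}"
    using Dv by (intro L2_set_cong) auto
  also have "\<dots> \<le> L2_set (\<lambda>i. \<Sum>j<m. a i j * v j) {..<n} + b * L2_set v {..<m}"
    by (rule order_trans[OF L2_set_triangle_ineq add_left_mono[OF b]])
  \<comment> \<open>Only indices j >= p contribute, and there \<open>d j\<close> is at most
    \<open>d p\<close>.\<close>
  also have "L2_set (\<lambda>i. \<Sum>j<m. a i j * v j) {..<n} \<le> sqrt (d p) * L2_set v {..<m}"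
  proof -
    have "d j * (v j)\<^sup>2 \<le> d p * (v j)\<^sup>2" if "j < m" for j
      using v0 d[of p j] that by (cases "j < p") (auto intro!: mult_right_mono)
    hence "(\<Sum>j<m. d j * (v j)\<^sup>2) \<le> d p * (\<Sum>j<m. (v j)\<^sup>2)"
      by (auto simp: sum_distrib_left intro!: sum_mono)
    thus ?thesis using sum_squares_orthogonal[where x = v, OF A]
      by (simp add: L2_set_def flip: real_sqrt_mult)
  qed
  finally have "s p * L2_set y {..<m} \<le> (b + sqrt (d p)) * L2_set y {..<m}"
    by (simp add: norm_v distrib_right)
  thus ?thesis using pos by simp
qed

lemma L2_set_mono2: "finite B \<Longrightarrow> A \<subseteq> B \<Longrightarrow> L2_set f A \<le> L2_set f B"
  unfolding L2_set_def by (intro real_sqrt_le_mono sum_mono2) auto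

lemma L2_set_Un_le:
  assumes "finite A" "finite B" "A \<inter> B = {}"
  shows "L2_set f (A \<union> B) \<le> L2_set f A + L2_set f B"
  unfolding L2_set_def sum.union_disjoint[OF assms]
  by (rule sqrt_add_le_add_sqrt) (auto intro: sum_nonneg)

text \<open>Here \<open>b\<close> is any bound on the operator norm of \<open>c\<close>, and
  \<open>k\<close> is orthogonal in both rows and columns. In this form every block is a rectangle
  of index pairs, and its Frobenius norm is an \<open>L2_set\<close>, for which the triangle
  inequality is at hand. The sum of \<open>d\<close> runs to \<open>m\<close> even if
  \<open>n\<close> is smaller; the excess terms are shown to vanish later.\<close>

lemma trailing_rows_bound_coordinates:
  fixes a c k :: "nat \<Rightarrow> nat \<Rightarrow> real" and s d :: "nat \<Rightarrow> real"
  assumes A: "\<And>j j'. j < m \<Longrightarrow> j' < m \<Longrightarrow> (\<Sum>i<n. a i j * a i j') = (if j = j' then d j else 0)"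
    and K: "\<And>i i'. i < m \<Longrightarrow> i' < m \<Longrightarrow> (\<Sum>l<m. k i l * k i' l) = (if i = i' then 1 else 0)"
    and K': "\<And>j j'. j < m \<Longrightarrow> j' < m \<Longrightarrow> (\<Sum>l<m. k l j * k l j') = (if j = j' then 1 else 0)"
    and D: "\<And>i j. i < n \<Longrightarrow> j < m \<Longrightarrow> a i j + c i j = (if i < m then s i * k i j else 0)"
    and s: "\<And>i j. i \<le> j \<Longrightarrow> j < min n m \<Longrightarrow> s j \<le> s i" "\<And>i. i < min n m \<Longrightarrow> 0 \<le> s i"
    and d: "\<And>i j. i \<le> j \<Longrightarrow> j < m \<Longrightarrow> d j \<le> d i"
    and b: "\<And>v. L2_set (\<lambda>i. \<Sum>j<m. c i j * v j) {..<n} \<le> b * L2_set v {..<m}" "0 \<le> b"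
    and R: "R \<le> min n m"
  shows "L2_set (case_prod a) ({R..<n} \<times> {..<m})
    \<le> 2 * sqrt (\<Sum>j=R..<m. d j) + 2 * min (sqrt R * b) (L2_set (case_prod c) ({..<n} \<times> {..<m}))"
proof -
  define e where "e = sqrt (\<Sum>j=R..<m. d j)"
  define D' where "D' i j = a i j + c i j" for i j
  have D'_split: "case_prod D' = (\<lambda>p. case_prod a p + case_prod c p)" by (auto simp: D'_def)
  define w where "w i = (\<Sum>j<R. (k i j)\<^sup>2)" for i
  have d0: "0 \<le> d j" if "j < m" for j
    using A[OF that that] by (metis (no_types, lifting) sum_nonneg zero_le_square)
  have w0: "0 \<le> w i" for i by (simp add: w_def sum_nonneg)
  have w1: "(\<Sum>j=R..<m. (k i j)\<^sup>2) = 1 - w i" if "i < m" for i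
  proof -
    have "{..<m} = {..<R} \<union> {R..<m}" using R by auto
    hence "(\<Sum>j<m. (k i j)\<^sup>2) = w i + (\<Sum>j=R..<m. (k i j)\<^sup>2)"
      by (simp add: w_def sum.union_disjoint ivl_disj_int)
    thus ?thesis using K[OF that that] by (simp add: power2_eq_square)
  qed
  have w_le: "w i \<le> 1" if "i < m" for i
    using w1[OF that] by (metis (no_types, lifting) diff_ge_0_iff_ge sum_nonneg zero_le_power2)
  \<comment> \<open>Summing the other way round counts the first R columns of \<open>k\<close>, each
    a unit vector.\<close>
  have w_sum: "(\<Sum>i<m. w i) = R"
  proof -
    have "(\<Sum>i<m. w i) = (\<Sum>j<R. \<Sum>i<m. (k i j)\<^sup>2)" unfolding w_def by (rule sum.swap)
    also have "\<dots> = (\<Sum>j<R. 1)"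
      using K' R by (intro sum.cong) (auto simp: power2_eq_square)
    finally show ?thesis by simp
  qed
  \<comment> \<open>Along row \<open>i\<close> the factor \<open>s i\<close> is constant, so the
    norm of a row segment is \<open>s i\<close> times that of the same segment of \<open>k\<close>;
    rows i >= m are zero, hence the intersection.\<close>
  have D_block: "L2_set (case_prod D') (I \<times> J)
      = L2_set (\<lambda>i. s i * sqrt (\<Sum>j\<in>J. (k i j)\<^sup>2)) (I \<inter> {..<m})"
    if "I \<subseteq> {..<n}" "J \<subseteq> {..<m}" for I J
  proof -
    have fin: "finite I" using that finite_subset by blast
    have "(\<Sum>(i, j)\<in>I \<times> J. (D' i j)\<^sup>2) = (\<Sum>i\<in>I. \<Sum>j\<in>J. (if i < m then s i * k i j else 0)\<^sup>2)"
    proof -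
      have "D' i j = (if i < m then s i * k i j else 0)" if "i \<in> I" "j \<in> J" for i j
      proof -
        have "i < n" "j < m"
          using that \<open>I \<subseteq> {..<n}\<close> \<open>J \<subseteq> {..<m}\<close> by (blast dest: lessThan_iff[THEN iffD1])+
        thus ?thesis using D by (simp add: D'_def)
      qed
      hence "(\<Sum>i\<in>I. \<Sum>j\<in>J. (D' i j)\<^sup>2) = (\<Sum>i\<in>I. \<Sum>j\<in>J. (if i < m then s i * k i j else 0)\<^sup>2)"
        by (intro sum.cong refl) simp
      thus ?thesis by (simp add: sum.cartesian_product)
    qed
    also have "\<dots> = (\<Sum>i\<in>I. if i \<in> {..<m} then (s i * sqrt (\<Sum>j\<in>J. (k i j)\<^sup>2))\<^sup>2 else 0)"
      by (intro sum.cong) (auto simp: power_mult_distrib sum_nonneg sum_distrib_left)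
    also have "\<dots> = (\<Sum>i\<in>I \<inter> {..<m}. (s i * sqrt (\<Sum>j\<in>J. (k i j)\<^sup>2))\<^sup>2)"
      using fin by (rule sum.inter_restrict[symmetric])
    finally show ?thesis by (simp add: L2_set_def case_prod_beta)
  qed
  have I: "{R..<n} \<inter> {..<m} = {R..<min n m}" "{..<n} \<inter> {..<m} = {..<min n m}" by auto
  have D1: "L2_set (case_prod D') ({R..<n} \<times> {..<R}) = L2_set (\<lambda>i. s i * sqrt (w i)) {R..<min n m}"
    using R by (subst D_block) (auto simp: I w_def)
  have a_right: "L2_set (case_prod a) ({..<n} \<times> {R..<m}) = e"
  proof -
    have "(\<Sum>(i, j)\<in>{..<n} \<times> {R..<m}. (a i j)\<^sup>2) = (\<Sum>j=R..<m. \<Sum>i<n. (a i j)\<^sup>2)"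
      by (subst sum.cartesian_product[symmetric]) (rule sum.swap)
    also have "\<dots> = (\<Sum>j=R..<m. d j)"
      using A by (intro sum.cong) (auto simp: power2_eq_square)
    finally show ?thesis by (simp add: L2_set_def case_prod_beta e_def)
  qed
  let ?C = "L2_set (case_prod c) ({..<n} \<times> {..<m})"
  have D_op: "L2_set (case_prod D') ({R..<n} \<times> {..<R}) \<le> sqrt R * b + e"
  proof -
    have weyl: "s i \<le> b + sqrt (d i)" if "i < min n m" for i
      using weyl_inequality_coordinates[where s = s, OF A K D s d b(1) that] by blast
    have "L2_set (\<lambda>i. s i * sqrt (w i)) {R..<min n m}
        \<le> L2_set (\<lambda>i. b * sqrt (w i) + sqrt (d i) * sqrt (w i)) {R..<min n m}"
      using weyl w0 s(2) by (intro L2_set_mono) (auto simp flip: distrib_right intro!: mult_right_mono)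
    \<comment> \<open>The two parts use different properties of the weights: their total R yields
      sqrt R in the part with \<open>b\<close>, and w i <= 1 discards them in the part with
      \<open>d\<close>.\<close>
    also have "\<dots> \<le> L2_set (\<lambda>i. b * sqrt (w i)) {R..<min n m}
        + L2_set (\<lambda>i. sqrt (d i) * sqrt (w i)) {R..<min n m}"
      by (rule L2_set_triangle_ineq)
    also have "L2_set (\<lambda>i. b * sqrt (w i)) {R..<min n m} \<le> b * sqrt R"
    proof -
      have "(\<Sum>i=R..<min n m. w i) \<le> (\<Sum>i<m. w i)" by (intro sum_mono2) (auto simp: w0)
      hence "L2_set (\<lambda>i. sqrt (w i)) {R..<min n m} \<le> sqrt R"
        unfolding w_sum by (simp add: L2_set_def w0)
      thus ?thesis using b(2) by (simp add: mult_left_mono flip: L2_set_right_distrib)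
    qed
    also have "L2_set (\<lambda>i. sqrt (d i) * sqrt (w i)) {R..<min n m} \<le> e"
    proof -
      have "(\<Sum>i=R..<min n m. d i * w i) \<le> (\<Sum>i=R..<min n m. d i)"
        using d0 w_le by (intro sum_mono) (auto intro!: mult_left_le)
      also have "\<dots> \<le> (\<Sum>i=R..<m. d i)" using d0 by (intro sum_mono2) auto
      finally show ?thesis using d0 w0 by (simp add: L2_set_def e_def power_mult_distrib)
    qed
    finally show ?thesis unfolding D1 by (simp add: mult.commute)
  qed
  have D_frob: "L2_set (case_prod D') ({R..<n} \<times> {..<R}) \<le> ?C + e"
  proof -
    \<comment> \<open>Eckart--Young: since w has total R and w \<le> 1, the mass of w beyond R equals the deficit of w
      from 1 on the first R indices, where s is larger\<close>
    have "(\<Sum>i=R..<min n m. (s i)\<^sup>2 * w i) \<le> (\<Sum>i<min n m. (s i)\<^sup>2 * (1 - w i))"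
    \<comment> \<open>The pivot is \<open>s R\<close>, an upper bound for the later
      \<open>s i\<close> and a lower bound for the earlier ones. It is a singular value only if R <
      min n m; otherwise the left sum is empty.\<close>
    proof (cases "R < min n m")
      case True
      have "(\<Sum>i=R..<min n m. (s i)\<^sup>2 * w i) \<le> (s R)\<^sup>2 * (\<Sum>i=R..<min n m. w i)"
        unfolding sum_distrib_left using s w0 by (intro sum_mono mult_right_mono power_mono) auto
      also have "(\<Sum>i=R..<min n m. w i) \<le> (\<Sum>i=R..<m. w i)"
        by (intro sum_mono2) (auto simp: w0)
      also have "\<dots> = (\<Sum>i<R. 1 - w i)"
      proof -
        have "{..<m} = {..<R} \<union> {R..<m}" using R by auto
        hence "real R = (\<Sum>i<R. w i) + (\<Sum>i=R..<m. w i)"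
          unfolding w_sum[symmetric] by (simp add: sum.union_disjoint ivl_disj_int)
        thus ?thesis by (simp add: sum_subtractf)
      qed
      also have "(s R)\<^sup>2 * (\<Sum>i<R. 1 - w i) \<le> (\<Sum>i<R. (s i)\<^sup>2 * (1 - w i))"
        unfolding sum_distrib_left using s w_le True
        by (intro sum_mono mult_right_mono power_mono) auto
      also have "\<dots> \<le> (\<Sum>i<min n m. (s i)\<^sup>2 * (1 - w i))"
        using w_le True by (intro sum_mono2) auto
      finally show ?thesis by (simp add: mult_left_mono)
    next
      case False
      thus ?thesis using w_le by (auto intro!: sum_nonneg)
    qed
    \<comment> \<open>The deficit 1 - w i is the mass of row \<open>i\<close> of \<open>k\<close> in
      the columns j >= R, so this is the squared norm of those columns of a + c.\<close>
    also have "\<dots> = (\<Sum>i<min n m. (s i * sqrt (\<Sum>j=R..<m. (k i j)\<^sup>2))\<^sup>2)"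
      using w1 w_le by (intro sum.cong) (auto simp: power_mult_distrib)
    finally have "L2_set (case_prod D') ({R..<n} \<times> {..<R}) \<le> L2_set (case_prod D') ({..<n} \<times> {R..<m})"
      unfolding D1 using R by (subst D_block) (auto simp: I L2_set_def power_mult_distrib w0)
    also have "\<dots> \<le> L2_set (case_prod a) ({..<n} \<times> {R..<m}) + L2_set (case_prod c) ({..<n} \<times> {R..<m})"
      unfolding D'_split by (rule L2_set_triangle_ineq)
    also have "L2_set (case_prod c) ({..<n} \<times> {R..<m}) \<le> ?C" by (rule L2_set_mono2) auto
    finally show ?thesis using a_right by simp
  qed
  have c_op: "L2_set (case_prod c) ({R..<n} \<times> {..<R}) \<le> sqrt R * b"
  proof -
    have col: "(\<Sum>i<n. (c i j)\<^sup>2) \<le> b\<^sup>2" if "j < m" for j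
    proof -
      \<comment> \<open>Column \<open>j\<close> of \<open>c\<close> is the image of the j-th unit
        vector, so its norm is at most \<open>b\<close>; R such columns produce the factor sqrt
        R.\<close>
      define v :: "nat \<Rightarrow> real" where "v l = (if l = j then 1 else 0)" for l
      have "(\<Sum>l<m. c i l * v l) = (\<Sum>l<m. if l = j then c i l else 0)" for i
        by (intro sum.cong) (auto simp: v_def)
      hence "(\<Sum>l<m. c i l * v l) = c i j" for i using that by simp
      moreover have "(\<Sum>l<m. (v l)\<^sup>2) = (\<Sum>l<m. if l = j then 1 else 0)"
        by (intro sum.cong) (auto simp: v_def)
      ultimately have "sqrt (\<Sum>i<n. (c i j)\<^sup>2) \<le> b"
        using b(1)[of v] that by (simp add: L2_set_def)
      thus ?thesis by (rule sqrt_le_D)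
    qed
    have "(\<Sum>(i, j)\<in>{..<n} \<times> {..<R}. (c i j)\<^sup>2) = (\<Sum>j<R. \<Sum>i<n. (c i j)\<^sup>2)"
      by (subst sum.cartesian_product[symmetric]) (rule sum.swap)
    also have "\<dots> \<le> (\<Sum>j<R. b\<^sup>2)" using col R by (intro sum_mono) auto
    finally have "L2_set (case_prod c) ({..<n} \<times> {..<R}) \<le> sqrt (R * b\<^sup>2)"
      by (simp add: L2_set_def case_prod_beta)
    also have "\<dots> = sqrt R * b" using b(2) by (simp add: real_sqrt_mult)
    finally show ?thesis by (rule order_trans[OF L2_set_mono2, rotated 2]) auto
  qed
  have c_frob: "L2_set (case_prod c) ({R..<n} \<times> {..<R}) \<le> ?C"
    using R by (intro L2_set_mono2) auto
  have split: "{R..<n} \<times> {..<m} = {R..<n} \<times> {..<R} \<union> {R..<n} \<times> {R..<m}" using R by auto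
  have "L2_set (case_prod a) ({R..<n} \<times> {..<m})
      \<le> L2_set (case_prod a) ({R..<n} \<times> {..<R}) + L2_set (case_prod a) ({R..<n} \<times> {R..<m})"
    unfolding split by (rule L2_set_Un_le) auto
  also have "L2_set (case_prod a) ({R..<n} \<times> {R..<m}) \<le> e"
    unfolding a_right[symmetric] by (rule L2_set_mono2) auto
  also have "L2_set (case_prod a) ({R..<n} \<times> {..<R})
      \<le> L2_set (case_prod D') ({R..<n} \<times> {..<R}) + L2_set (case_prod c) ({R..<n} \<times> {..<R})"
  proof -
    have "L2_set (case_prod a) ({R..<n} \<times> {..<R})
        = L2_set (\<lambda>p. case_prod D' p + - case_prod c p) ({R..<n} \<times> {..<R})"
      unfolding D'_split by simp
    also have "\<dots> \<le> L2_set (case_prod D') ({R..<n} \<times> {..<R}) + L2_set (\<lambda>p. - case_prod c p) ({R..<n} \<times> {..<R})"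
      by (rule L2_set_triangle_ineq)
    finally show ?thesis by (simp add: L2_set_def)
  qed
  finally have "L2_set (case_prod a) ({R..<n} \<times> {..<m})
      \<le> L2_set (case_prod D') ({R..<n} \<times> {..<R}) + L2_set (case_prod c) ({R..<n} \<times> {..<R}) + e"
    by (simp only: add_le_cancel_right)
  moreover have "L2_set (case_prod D') ({R..<n} \<times> {..<R}) \<le> e + min (sqrt R * b) ?C"
    using D_op D_frob by (simp only: min_add_distrib_right min.bounded_iff add.commute[of e])
  moreover have "L2_set (case_prod c) ({R..<n} \<times> {..<R}) \<le> min (sqrt R * b) ?C"
    using c_op c_frob by (simp only: min.bounded_iff)
  ultimately show ?thesis unfolding e_def[symmetric] by (simp only: mult_2)
qed

section \<open>Norms and matrices with orthonormal columns\<close>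

lemma vec_norm2_L2_set: "vec_norm2 v = L2_set (\<lambda>i. v $ i) {..<dim_vec v}"
  by (simp add: vec_norm2_def L2_set_def scalar_prod_def power2_eq_square atLeast0LessThan)

lemma frob_norm_L2_set:
  "frob_norm A = L2_set (\<lambda>(i, j). A $$ (i, j)) ({..<dim_row A} \<times> {..<dim_col A})"
  by (simp add: frob_norm_def L2_set_def sum.cartesian_product case_prod_beta)

lemma mult_mat_index:
  "i < dim_row A \<Longrightarrow> j < dim_col B \<Longrightarrow> dim_col A = dim_row B \<Longrightarrow>
    (A * B) $$ (i, j) = (\<Sum>l<dim_row B. A $$ (i, l) * B $$ (l, j))"
  by (simp add: scalar_prod_def atLeast0LessThan)

text \<open>The hypotheses are equations between dimensions, so rewriting need not guess the sizes
  of carriers.\<close>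

lemma assoc_mult_mat_dim:
  "dim_col A = dim_row B \<Longrightarrow> dim_col B = dim_row C \<Longrightarrow> A * B * C = A * (B * C)"
  for A :: "'a :: semiring_0 mat"
  by (rule assoc_mult_mat) auto

lemma transpose_mult_dim:
  "dim_col A = dim_row B \<Longrightarrow> (A * B)\<^sup>T = B\<^sup>T * A\<^sup>T"
  for A :: "'a :: comm_semiring_0 mat"
  by (rule transpose_mult) auto

lemma left_mult_one_mat_dim: "dim_row A = n \<Longrightarrow> 1\<^sub>m n * A = A"
  for A :: "'a :: semiring_1 mat"
  by (rule left_mult_one_mat) auto

lemma orthonormal_cols_index:
  assumes "orthonormal_cols U" "j < dim_col U" "j' < dim_col U"
  shows "(\<Sum>i<dim_row U. U $$ (i, j) * U $$ (i, j')) = (if j = j' then 1 else 0)"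
proof -
  have "(U\<^sup>T * U) $$ (j, j') = (\<Sum>i<dim_row U. U $$ (i, j) * U $$ (i, j'))"
    using assms by (subst mult_mat_index) auto
  moreover have "(U\<^sup>T * U) $$ (j, j') = (if j = j' then 1 else 0)"
    using assms by (simp only: orthonormal_cols_def index_one_mat)
  ultimately show ?thesis by simp
qed

lemma orthonormal_cols_cancel:
  assumes "orthonormal_cols U" "dim_row M = dim_col U"
  shows "U\<^sup>T * (U * M) = M"
  using assms by (simp add: orthonormal_cols_def left_mult_one_mat_dim flip: assoc_mult_mat_dim)

text \<open>For a square matrix a left inverse is also a right inverse.\<close>

lemma orthonormal_cols_transpose:
  assumes "orthonormal_cols U" "U \<in> carrier_mat n n"
  shows "orthonormal_cols U\<^sup>T"
proof -
  have "U\<^sup>T * U = 1\<^sub>m n" using assms by (auto simp: orthonormal_cols_def)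
  hence "U * U\<^sup>T = 1\<^sub>m n" 
    using mat_mult_left_right_inverse[of "U\<^sup>T" n U] assms(2) by (simp only: transpose_carrier_mat)
  thus ?thesis using assms(2) by (auto simp: orthonormal_cols_def)
qed

lemma orthonormal_cols_mult:
  assumes "orthonormal_cols U" "orthonormal_cols V" "dim_col U = dim_row V"
  shows "orthonormal_cols (U * V)"
proof -
  have "(U * V)\<^sup>T * (U * V) = V\<^sup>T * (U\<^sup>T * (U * V))"
    using assms(3) by (simp add: transpose_mult_dim assoc_mult_mat_dim)
  also have "\<dots> = V\<^sup>T * V" using assms by (subst orthonormal_cols_cancel) auto
  also have "\<dots> = 1\<^sub>m (dim_col V)" using assms(2) by (simp only: orthonormal_cols_def)
  finally show ?thesis by (simp add: orthonormal_cols_def)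
qed

lemma vec_norm2_orthonormal_cols:
  assumes U: "orthonormal_cols U" and v: "v \<in> carrier_vec (dim_col U)"
  shows "vec_norm2 (U *\<^sub>v v) = vec_norm2 v"
proof -
  have "(\<Sum>i<dim_row U. (\<Sum>j<dim_col U. U $$ (i, j) * v $ j)\<^sup>2) = (\<Sum>j<dim_col U. 1 * (v $ j)\<^sup>2)"
    using orthonormal_cols_index[OF U] by (intro sum_squares_orthogonal) auto
  thus ?thesis using v
    by (simp add: vec_norm2_L2_set L2_set_def scalar_prod_def atLeast0LessThan)
qed

lemma frob_norm_cols: "frob_norm A = L2_set (\<lambda>j. vec_norm2 (col A j)) {..<dim_col A}"
proof -
  have "(\<Sum>i<dim_row A. \<Sum>j<dim_col A. (A $$ (i, j))\<^sup>2) = (\<Sum>j<dim_col A. (vec_norm2 (col A j))\<^sup>2)"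
    by (subst sum.swap) (simp add: vec_norm2_L2_set L2_set_def sum_nonneg)
  thus ?thesis by (simp add: frob_norm_def L2_set_def)
qed

lemma frob_norm_orthonormal_left:
  assumes "orthonormal_cols U" "dim_row M = dim_col U"
  shows "frob_norm (U * M) = frob_norm M"
proof -
  have "vec_norm2 (col (U * M) j) = vec_norm2 (col M j)" if "j < dim_col M" for j
  proof -
    have "col (U * M) j = U *\<^sub>v col M j" using that assms by (intro eq_vecI) auto
    moreover have "col M j \<in> carrier_vec (dim_col U)" by (metis assms(2) col_dim)
    ultimately show ?thesis using vec_norm2_orthonormal_cols[OF assms(1)] by metis
  qed
  thus ?thesis unfolding frob_norm_cols by (intro L2_set_cong) auto
qed

lemma frob_norm_transpose: "frob_norm A\<^sup>T = frob_norm A"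
proof -
  have "(\<Sum>i<dim_col A. \<Sum>j<dim_row A. (A\<^sup>T $$ (i, j))\<^sup>2)
      = (\<Sum>i<dim_col A. \<Sum>j<dim_row A. (A $$ (j, i))\<^sup>2)"
    by (intro sum.cong) auto
  also have "\<dots> = (\<Sum>j<dim_row A. \<Sum>i<dim_col A. (A $$ (j, i))\<^sup>2)" by (rule sum.swap)
  finally show ?thesis by (simp add: frob_norm_def)
qed

text \<open>Transposition reduces this to multiplication from the left; \<open>Q\<close> is square
  so that its transpose has orthonormal columns too.\<close>

lemma frob_norm_orthonormal_right:
  assumes "orthonormal_cols Q" "Q \<in> carrier_mat n n" "dim_col M = n"
  shows "frob_norm (M * Q) = frob_norm M"
proof -
  have "frob_norm (M * Q) = frob_norm (Q\<^sup>T * M\<^sup>T)"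
    using assms by (subst frob_norm_transpose[symmetric]) (simp add: transpose_mult_dim)
  also have "\<dots> = frob_norm M"
    using assms orthonormal_cols_transpose[OF assms(1,2)]
    by (subst frob_norm_orthonormal_left) (auto simp: frob_norm_transpose)
  finally show ?thesis .
qed

lemma vec_norm2_smult: "vec_norm2 (c \<cdot>\<^sub>v v) = \<bar>c\<bar> * vec_norm2 v"
proof -
  have "(c \<cdot>\<^sub>v v) \<bullet> (c \<cdot>\<^sub>v v) = c\<^sup>2 * (v \<bullet> v)" by (simp add: power2_eq_square)
  thus ?thesis by (simp add: vec_norm2_def real_sqrt_mult)
qed

text \<open>Cauchy-Schwarz in each row. This crude bound shows that the supremum defining
  \<open>op_norm\<close> is over a bounded set.\<close>

lemma vec_norm2_mult_le_frob_norm: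
  assumes "v \<in> carrier_vec (dim_col A)"
  shows "vec_norm2 (A *\<^sub>v v) \<le> frob_norm A * vec_norm2 v"
proof -
  have "(\<Sum>i<dim_row A. (\<Sum>j<dim_col A. A $$ (i, j) * v $ j)\<^sup>2)
      \<le> (\<Sum>i<dim_row A. (\<Sum>j<dim_col A. (A $$ (i, j))\<^sup>2) * (\<Sum>j<dim_col A. (v $ j)\<^sup>2))"
  proof (intro sum_mono)
    fix i
    have "\<bar>\<Sum>j<dim_col A. A $$ (i, j) * v $ j\<bar>
        \<le> L2_set (\<lambda>j. A $$ (i, j)) {..<dim_col A} * L2_set (\<lambda>j. v $ j) {..<dim_col A}"
      by (rule order_trans[OF sum_abs]) (simp add: abs_mult L2_set_mult_ineq)
    from power_mono[OF this abs_ge_zero, of 2] have "(\<Sum>j<dim_col A. A $$ (i, j) * v $ j)\<^sup>2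
        \<le> (L2_set (\<lambda>j. A $$ (i, j)) {..<dim_col A} * L2_set (\<lambda>j. v $ j) {..<dim_col A})\<^sup>2"
      by (simp only: power2_abs)
    thus "(\<Sum>j<dim_col A. A $$ (i, j) * v $ j)\<^sup>2
        \<le> (\<Sum>j<dim_col A. (A $$ (i, j))\<^sup>2) * (\<Sum>j<dim_col A. (v $ j)\<^sup>2)"
      by (simp add: L2_set_def power_mult_distrib sum_nonneg)
  qed
  thus ?thesis using assms
    by (simp add: vec_norm2_L2_set frob_norm_def L2_set_def scalar_prod_def atLeast0LessThan
        flip: real_sqrt_mult sum_distrib_right)
qed

lemma op_norm_bdd:
  "bdd_above {vec_norm2 (A *\<^sub>v v) | v. v \<in> carrier_vec (dim_col A) \<and> vec_norm2 v \<le> 1}"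
proof (rule bdd_aboveI)
  fix x assume "x \<in> {vec_norm2 (A *\<^sub>v v) | v. v \<in> carrier_vec (dim_col A) \<and> vec_norm2 v \<le> 1}"
  then obtain v where v: "x = vec_norm2 (A *\<^sub>v v)" "v \<in> carrier_vec (dim_col A)" "vec_norm2 v \<le> 1"
    by blast
  have "0 \<le> frob_norm A" by (simp add: frob_norm_L2_set)
  hence "frob_norm A * vec_norm2 v \<le> frob_norm A" using v(3) by (simp add: mult_left_le)
  thus "x \<le> frob_norm A" using vec_norm2_mult_le_frob_norm[OF v(2)] v(1) by simp
qed

lemma vec_norm2_mult_le_op_norm_unit:
  assumes "v \<in> carrier_vec (dim_col A)" "vec_norm2 v \<le> 1"
  shows "vec_norm2 (A *\<^sub>v v) \<le> op_norm A"
  unfolding op_norm_def by (rule cSup_upper[OF _ op_norm_bdd]) (use assms in blast)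

lemma op_norm_nonneg: "0 \<le> op_norm A"
proof -
  have "0 \<le> vec_norm2 (A *\<^sub>v 0\<^sub>v (dim_col A))" by (simp add: vec_norm2_L2_set)
  also have "\<dots> \<le> op_norm A"
    by (rule vec_norm2_mult_le_op_norm_unit) (auto simp: vec_norm2_def)
  finally show ?thesis .
qed

text \<open>Rescaling to a unit vector; for a vector of norm 0, which cannot be rescaled, the
  Frobenius bound gives 0 on the left.\<close>

lemma vec_norm2_mult_le_op_norm:
  assumes v: "v \<in> carrier_vec (dim_col A)"
  shows "vec_norm2 (A *\<^sub>v v) \<le> op_norm A * vec_norm2 v"
proof (cases "vec_norm2 v = 0")
  case True
  thus ?thesis using vec_norm2_mult_le_frob_norm[OF v] by simp
next
  case False
  hence pos: "vec_norm2 v > 0" by (simp add: vec_norm2_L2_set order_less_le)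
  define u where "u = (1 / vec_norm2 v) \<cdot>\<^sub>v v"
  have "vec_norm2 (A *\<^sub>v u) \<le> op_norm A"
    using v pos by (intro vec_norm2_mult_le_op_norm_unit) (auto simp: u_def vec_norm2_smult)
  moreover have "A *\<^sub>v u = (1 / vec_norm2 v) \<cdot>\<^sub>v (A *\<^sub>v v)"
    unfolding u_def using v by (intro mult_mat_vec[of _ "dim_row A" "dim_col A"]) auto
  ultimately show ?thesis using pos by (simp add: vec_norm2_smult field_simps)
qed

section \<open>From matrices to coordinates\<close>

text \<open>Columns 0 to \<open>n\<close> are n + 1 vectors of length \<open>n\<close>, hence
  dependent; by Pythagoras some \<open>d j\<close> with j <= n is 0, and monotonicity carries this
  to \<open>i\<close>. It reconciles the \<open>m\<close> eigenvalues of X^T X with the min n m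
  singular values.\<close>

lemma orthogonal_family_tail_zero:
  fixes a :: "nat \<Rightarrow> nat \<Rightarrow> real"
  assumes A: "\<And>j j'. j < m \<Longrightarrow> j' < m \<Longrightarrow> (\<Sum>i<n. a i j * a i j') = (if j = j' then d j else 0)"
    and d: "\<And>i j. i \<le> j \<Longrightarrow> j < m \<Longrightarrow> d j \<le> d i"
    and i: "n \<le> i" "i < m"
  shows "d i = 0"
proof -
  have d0: "0 \<le> d j" if "j < m" for j
    using A[OF that that] by (metis (no_types, lifting) sum_nonneg zero_le_square)
  obtain x where x: "\<exists>j\<le>n. x j \<noteq> 0" "\<And>i. i < n \<Longrightarrow> (\<Sum>j\<le>n. a i j * x j) = 0"
    using underdetermined_system[of n a] by blast
  define y where "y j = (if j \<le> n then x j else 0)" for j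
  have y: "(\<Sum>j<m. a i j * y j) = 0" if "i < n" for i
  proof -
    have "(\<Sum>j<m. a i j * y j) = (\<Sum>j\<le>n. a i j * y j)"
      by (rule sum.mono_neutral_right) (use i in \<open>auto simp: y_def\<close>)
    thus ?thesis using x(2)[OF that] by (simp add: y_def)
  qed
  have "(\<Sum>j<m. d j * (y j)\<^sup>2) = 0"
    using sum_squares_orthogonal[where m = m and x = y, OF A] y by simp
  hence zero: "d j * (y j)\<^sup>2 = 0" if "j < m" for j
    using that d0 by (subst (asm) sum_nonneg_eq_0_iff) auto
  obtain j where j: "j \<le> n" "x j \<noteq> 0" using x(1) by blast
  have "d j = 0" using zero[of j] j i by (simp add: y_def)
  thus ?thesis using d[of j i] d0[of i] i j by simp
qed

text \<open>The left factor cancels in the Gram matrix, so orthogonality of the columns, due to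
  \<open>Q\<close>, survives any left rotation.\<close>

lemma gram_of_diagonalization:
  assumes X: "X \<in> carrier_mat n m" and Q: "Q \<in> carrier_mat m m"
    and U: "U \<in> carrier_mat n n" "orthonormal_cols U"
    and diag: "Q\<^sup>T * (X\<^sup>T * X) * Q = mat m m (\<lambda>(i, j). if i = j then d i else 0)"
    and j: "j < m" "j' < m"
  shows "(\<Sum>i<n. (U * X * Q) $$ (i, j) * (U * X * Q) $$ (i, j')) = (if j = j' then d j else 0)"
proof -
  let ?G = "U * X * Q"
  have "?G\<^sup>T * ?G = Q\<^sup>T * (X\<^sup>T * (U\<^sup>T * (U * (X * Q))))"
    using X Q U(1) by (simp add: transpose_mult_dim assoc_mult_mat_dim)
  also have "U\<^sup>T * (U * (X * Q)) = X * Q" using X Q U by (intro orthonormal_cols_cancel) auto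
  also have "Q\<^sup>T * (X\<^sup>T * (X * Q)) = Q\<^sup>T * (X\<^sup>T * X) * Q"
    using X Q by (simp add: assoc_mult_mat_dim)
  finally have "?G\<^sup>T * ?G = mat m m (\<lambda>(i, j). if i = j then d i else 0)" using diag by simp
  hence "(?G\<^sup>T * ?G) $$ (j, j') = (if j = j' then d j else 0)" using j by simp
  moreover have "(?G\<^sup>T * ?G) $$ (j, j') = (\<Sum>i<n. ?G $$ (i, j) * ?G $$ (i, j'))"
    using j X Q U(1) by (subst mult_mat_index) auto
  ultimately show ?thesis by simp
qed

lemma sum_squares_singular_values:
  assumes X: "X \<in> carrier_mat n m" and Q: "Q \<in> carrier_mat m m" "orthonormal_cols Q"
    and diag: "Q\<^sup>T * (X\<^sup>T * X) * Q = mat m m (\<lambda>(i, j). if i = j then d i else 0)"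
    and dec: "\<And>i j. i \<le> j \<Longrightarrow> j < m \<Longrightarrow> d j \<le> d i"
  shows "(\<Sum>j=R+1..min n m. (singular_value j X)\<^sup>2) = (\<Sum>i=R..<min n m. d i)"
proof -
  \<comment> \<open>Taking the identity as left factor shows that each \<open>d j\<close> is a
    squared norm, so squaring its square root returns it.\<close>
  have gram: "(\<Sum>i<n. (1\<^sub>m n * X * Q) $$ (i, j) * (1\<^sub>m n * X * Q) $$ (i, j')) = (if j = j' then d j else 0)"
    if "j < m" "j' < m" for j j'
    by (rule gram_of_diagonalization[OF X Q(1) _ _ diag that]) (auto simp: orthonormal_cols_def)
  have d0: "0 \<le> d j" if "j < m" for j
    using gram[OF that that] by (metis (no_types, lifting) sum_nonneg zero_le_square)
  have "(\<Sum>j=R+1..min n m. (singular_value j X)\<^sup>2) = (\<Sum>j=R+1..min n m. d (j - 1))"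
    using singular_value_of_diagonalization[OF X Q diag dec] d0 by (intro sum.cong) auto
  also have "\<dots> = (\<Sum>i=R..<min n m. d i)"
    by (rule sum.reindex_bij_witness[of _ Suc "\<lambda>j. j - 1"]) auto
  finally show ?thesis .
qed

text \<open>Later proofs cite these facts by position: 1-6 are the sizes of the blocks, 7-10 the
  orthogonal factors, 11-14 the diagonal factor and 15 the factorisation.\<close>

lemma block_svdD:
  assumes "is_block_svd R Y U Up S Sp V Vp" "Y \<in> carrier_mat n m"
  defines "Uh \<equiv> append_cols U Up" and "Vh \<equiv> append_cols V Vp"
    and "Sh \<equiv> four_block_mat S (0\<^sub>m R (m - R)) (0\<^sub>m (n - R) R) Sp"
  shows "U \<in> carrier_mat n R" "Up \<in> carrier_mat n (n - R)" "S \<in> carrier_mat R R"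
    "Sp \<in> carrier_mat (n - R) (m - R)" "V \<in> carrier_mat m R" "Vp \<in> carrier_mat m (m - R)"
    "Uh \<in> carrier_mat n n" "orthonormal_cols Uh" "Vh \<in> carrier_mat m m" "orthonormal_cols Vh"
    "Sh \<in> carrier_mat n m" "diagonal_mat Sh" "\<And>i. i < min n m \<Longrightarrow> 0 \<le> Sh $$ (i, i)"
    "\<And>i j. i \<le> j \<Longrightarrow> j < min n m \<Longrightarrow> Sh $$ (j, j) \<le> Sh $$ (i, i)" "Y = Uh * Sh * Vh\<^sup>T"
  using assms(1,2) unfolding is_block_svd_def is_full_svd_def Uh_def Vh_def Sh_def by auto

text \<open>The outer factor \<open>Up\<close> of the projection is an isometry and drops out,
  leaving Up^T X, whose rows are the rows from R on of Uh^T X; \<open>Q\<close> on the right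
  preserves the norm.\<close>

lemma frob_norm_col_proj_trailing:
  assumes U: "U \<in> carrier_mat n R" and Up: "Up \<in> carrier_mat n (n - R)" and R: "R \<le> n"
    and orth: "orthonormal_cols (append_cols U Up)"
    and X: "X \<in> carrier_mat n m" and Q: "Q \<in> carrier_mat m m" "orthonormal_cols Q"
  shows "frob_norm (col_proj Up * X)
    = L2_set (\<lambda>(i, j). ((append_cols U Up)\<^sup>T * X * Q) $$ (i, j)) ({R..<n} \<times> {..<m})"
proof -
  let ?Uh = "append_cols U Up"
  let ?G = "?Uh\<^sup>T * (X * Q)"
  have Uh: "?Uh \<in> carrier_mat n n"
    by (intro carrier_matI) (use U Up R in \<open>auto simp: append_cols_def\<close>)
  have idx: "?Uh $$ (l, i + R) = Up $$ (l, i)" if "l < n" "i < n - R" for l i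
    using that U Up by (simp add: append_cols_def)
  have "orthonormal_cols Up"
    unfolding orthonormal_cols_def
  proof (rule eq_matI)
    fix i j assume "i < dim_row (1\<^sub>m (dim_col Up) :: real mat)" "j < dim_col (1\<^sub>m (dim_col Up) :: real mat)"
    hence ij: "i < n - R" "j < n - R" using Up by auto
    have "(Up\<^sup>T * Up) $$ (i, j) = (\<Sum>l<n. Up $$ (l, i) * Up $$ (l, j))"
      using ij Up by (subst mult_mat_index) auto
    also have "\<dots> = (\<Sum>l<n. ?Uh $$ (l, i + R) * ?Uh $$ (l, j + R))"
      using idx ij by (intro sum.cong) auto
    also have "\<dots> = (if i + R = j + R then 1 else 0)"
      using orthonormal_cols_index[OF orth, of "i + R" "j + R"] Uh ij by simp
    finally show "(Up\<^sup>T * Up) $$ (i, j) = 1\<^sub>m (dim_col Up) $$ (i, j)" using ij Up by simp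
  qed auto
  hence "frob_norm (col_proj Up * X) = frob_norm (Up\<^sup>T * X)"
    using X Up by (simp add: col_proj_def assoc_mult_mat_dim frob_norm_orthonormal_left)
  also have "\<dots> = frob_norm (Up\<^sup>T * (X * Q))"
    using X Q Up frob_norm_orthonormal_right[OF Q(2,1), of "Up\<^sup>T * X"]
    by (simp add: assoc_mult_mat_dim)
  also have "\<dots> = sqrt (\<Sum>i<n - R. \<Sum>j<m. (?G $$ (i + R, j))\<^sup>2)"
  proof -
    have "(Up\<^sup>T * (X * Q)) $$ (i, j) = ?G $$ (i + R, j)" if ij: "i < n - R" "j < m" for i j
    proof -
      have "(Up\<^sup>T * (X * Q)) $$ (i, j) = (\<Sum>l<n. Up $$ (l, i) * (X * Q) $$ (l, j))"
        using ij X Q Up by (subst mult_mat_index) auto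
      also have "\<dots> = (\<Sum>l<n. ?Uh $$ (l, i + R) * (X * Q) $$ (l, j))"
        using idx ij by (intro sum.cong) auto
      also have "\<dots> = ?G $$ (i + R, j)"
        using ij X Q Uh by (subst mult_mat_index) auto
      finally show ?thesis .
    qed
    thus ?thesis using X Q Up
      unfolding frob_norm_def by (intro arg_cong[of _ _ sqrt] sum.cong) auto
  qed
  also have "(\<Sum>i<n - R. \<Sum>j<m. (?G $$ (i + R, j))\<^sup>2) = (\<Sum>i=R..<n. \<Sum>j<m. (?G $$ (i, j))\<^sup>2)"
    by (rule sum.reindex_bij_witness[of _ "\<lambda>i. i - R" "\<lambda>i. i + R"]) (use R in auto)
  also have "?G = ?Uh\<^sup>T * X * Q" using Uh X Q by (simp add: assoc_mult_mat_dim)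
  finally show ?thesis by (simp add: L2_set_def sum.cartesian_product case_prod_beta)
qed

lemma frob_norm_col_proj_trailing_le:
  assumes X: "X \<in> carrier_mat n m" and Z: "Z \<in> carrier_mat n m" and R: "R \<le> min n m"
    and svd: "is_block_svd R (X + Z) U Up S Sp V Vp"
  shows "frob_norm (col_proj Up * X)
    \<le> 2 * sqrt (\<Sum>j=R+1..min n m. (singular_value j X)\<^sup>2)
      + 2 * min (sqrt (real R) * op_norm Z) (frob_norm Z)"
proof -
  define Uh where "Uh = append_cols U Up"
  define Vh where "Vh = append_cols V Vp"
  define Sh where "Sh = four_block_mat S (0\<^sub>m R (m - R)) (0\<^sub>m (n - R) R) Sp"
  have "X + Z \<in> carrier_mat n m" using X Z by simp
  note D = block_svdD[OF svd this, folded Uh_def Vh_def Sh_def]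
  have "(X\<^sup>T * X)\<^sup>T = X\<^sup>T * X" "X\<^sup>T * X \<in> carrier_mat m m"
    using X by (auto simp: transpose_mult_dim)
  from symmetric_diagonalization[OF this(2,1)] obtain Q d where
    Q: "Q \<in> carrier_mat m m" "orthonormal_cols Q"
    and diag: "Q\<^sup>T * (X\<^sup>T * X) * Q = mat m m (\<lambda>(i, j). if i = j then d i else 0)"
    and dec: "\<And>i j. i \<le> j \<Longrightarrow> j < m \<Longrightarrow> d j \<le> d i" by blast
  define a where "a i j = (Uh\<^sup>T * X * Q) $$ (i, j)" for i j
  define c where "c i j = (Uh\<^sup>T * Z * Q) $$ (i, j)" for i j
  define k where "k i j = (Vh\<^sup>T * Q) $$ (i, j)" for i j
  define s where "s i = Sh $$ (i, i)" for i
  have UhT: "Uh\<^sup>T \<in> carrier_mat n n" "orthonormal_cols Uh\<^sup>T"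
    using D(7) orthonormal_cols_transpose[OF D(8,7)] by auto
  have K: "Vh\<^sup>T * Q \<in> carrier_mat m m" "orthonormal_cols (Vh\<^sup>T * Q)"
    using D(9) Q orthonormal_cols_transpose[OF D(10,9)] by (auto intro: orthonormal_cols_mult)
  have A: "(\<Sum>i<n. a i j * a i j') = (if j = j' then d j else 0)" if "j < m" "j' < m" for j j'
    unfolding a_def by (rule gram_of_diagonalization[OF X Q(1) UhT diag that])
  have k_cols: "(\<Sum>l<m. k l j * k l j') = (if j = j' then 1 else 0)" if "j < m" "j' < m" for j j'
    using orthonormal_cols_index[OF K(2), of j j'] K(1) that by (simp only: k_def carrier_matD)
  have k_rows: "(\<Sum>l<m. k i l * k i' l) = (if i = i' then 1 else 0)" if "i < m" "i' < m" for i i'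
  proof -
    have "(\<Sum>l<m. (Vh\<^sup>T * Q)\<^sup>T $$ (l, i) * (Vh\<^sup>T * Q)\<^sup>T $$ (l, i')) = (if i = i' then 1 else 0)"
      using orthonormal_cols_index[OF orthonormal_cols_transpose[OF K(2,1)], of i i'] K(1) that
      by (simp only: index_transpose_mat carrier_matD)
    moreover have "(\<Sum>l<m. k i l * k i' l)
        = (\<Sum>l<m. (Vh\<^sup>T * Q)\<^sup>T $$ (l, i) * (Vh\<^sup>T * Q)\<^sup>T $$ (l, i'))"
      unfolding k_def using that K(1)
      by (intro sum.cong refl) (simp only: index_transpose_mat carrier_matD lessThan_iff)
    ultimately show ?thesis by simp
  qed
  \<comment> \<open>This is Uh^T Y Q = Sh Vh^T Q entry by entry. Row \<open>i\<close> of
    \<open>Sh\<close> has its only possible nonzero entry in column \<open>i\<close>, which does not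
    exist for i >= m.\<close>
  have split: "a i j + c i j = (if i < m then s i * k i j else 0)" if ij: "i < n" "j < m" for i j
  proof -
    have "a i j + c i j = (Uh\<^sup>T * X * Q + Uh\<^sup>T * Z * Q) $$ (i, j)"
      unfolding a_def c_def using ij UhT(1) X Z Q(1) by (subst index_add_mat) auto
    also have "Uh\<^sup>T * X * Q + Uh\<^sup>T * Z * Q = Uh\<^sup>T * ((X + Z) * Q)"
      using UhT(1) X Z Q(1)
      by (simp add: assoc_mult_mat_dim add_mult_distrib_mat[OF X Z Q(1)]
        mult_add_distrib_mat[of _ n n _ m])
    also have "\<dots> = Uh\<^sup>T * (Uh * (Sh * (Vh\<^sup>T * Q)))"
      using D(7,9,11) Q(1) by (subst D(15)) (simp add: assoc_mult_mat_dim)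
    also have "\<dots> = Sh * (Vh\<^sup>T * Q)"
      using D(7,11) by (intro orthonormal_cols_cancel[OF D(8)]) auto
    also have "(Sh * (Vh\<^sup>T * Q)) $$ (i, j) = (\<Sum>l<m. Sh $$ (i, l) * k l j)"
      unfolding k_def using ij D(9,11) Q(1) by (subst mult_mat_index) auto
    also have "\<dots> = (\<Sum>l<m. if l = i then s i * k i j else 0)"
      using D(11,12) ij by (intro sum.cong) (auto simp: s_def diagonal_mat_def)
    finally show ?thesis by simp
  qed
  have b: "L2_set (\<lambda>i. \<Sum>j<m. c i j * v j) {..<n} \<le> op_norm Z * L2_set v {..<m}" for v
  proof -
    define u where "u = vec m v"
    have u: "u \<in> carrier_vec m" by (simp add: u_def)
    have "L2_set (\<lambda>i. \<Sum>j<m. c i j * v j) {..<n} = vec_norm2 ((Uh\<^sup>T * Z * Q) *\<^sub>v u)"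
      unfolding vec_norm2_L2_set c_def using UhT(1) Q(1) Z
      by (intro L2_set_cong) (auto simp: u_def scalar_prod_def atLeast0LessThan)
    also have "(Uh\<^sup>T * Z * Q) *\<^sub>v u = Uh\<^sup>T *\<^sub>v (Z *\<^sub>v (Q *\<^sub>v u))"
      using UhT(1) Q(1) Z u by (simp add: assoc_mult_mat_vec[of _ n m _ m] assoc_mult_mat_vec[of _ n n _ m])
    also have "vec_norm2 \<dots> = vec_norm2 (Z *\<^sub>v (Q *\<^sub>v u))"
      using D(7) mult_mat_vec_carrier[OF Z mult_mat_vec_carrier[OF Q(1) u]]
      by (intro vec_norm2_orthonormal_cols[OF UhT(2)]) (simp only: index_transpose_mat carrier_matD)
    also have "\<dots> \<le> op_norm Z * vec_norm2 (Q *\<^sub>v u)"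
      using Z Q(1) u by (intro vec_norm2_mult_le_op_norm) auto
    also have "vec_norm2 (Q *\<^sub>v u) = vec_norm2 u"
      using Q u by (intro vec_norm2_orthonormal_cols) auto
    also have "vec_norm2 u = L2_set v {..<m}"
      unfolding vec_norm2_L2_set by (intro L2_set_cong) (auto simp: u_def)
    finally show ?thesis .
  qed
  have tail: "(\<Sum>j=R..<m. d j) = (\<Sum>j=R+1..min n m. (singular_value j X)\<^sup>2)"
  proof -
    have "(\<Sum>j=R..<m. d j) = (\<Sum>j=R..<min n m. d j)"
    proof (rule sum.mono_neutral_right)
      have "d i = 0" if "n \<le> i" "i < m" for i
        by (rule orthogonal_family_tail_zero[where a = a and d = d, OF A dec that])
      thus "\<forall>i\<in>{R..<m} - {R..<min n m}. d i = 0" by auto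
    qed auto
    thus ?thesis by (simp only: sum_squares_singular_values[OF X Q diag dec])
  qed
  have frob_c: "L2_set (case_prod c) ({..<n} \<times> {..<m}) = frob_norm Z"
  proof -
    have "L2_set (case_prod c) ({..<n} \<times> {..<m}) = frob_norm (Uh\<^sup>T * (Z * Q))"
      unfolding frob_norm_L2_set c_def using UhT(1) Z Q(1)
      by (intro L2_set_cong) (auto simp: assoc_mult_mat_dim)
    also have "\<dots> = frob_norm (Z * Q)" using UhT Z by (intro frob_norm_orthonormal_left) auto
    also have "\<dots> = frob_norm Z" using Q Z by (intro frob_norm_orthonormal_right) auto
    finally show ?thesis .
  qed
  have "frob_norm (col_proj Up * X) = L2_set (case_prod a) ({R..<n} \<times> {..<m})"
    unfolding a_def Uh_def using D(1,2,8) R X Q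
    by (intro frob_norm_col_proj_trailing) (auto simp: Uh_def)
  also have "\<dots> \<le> 2 * sqrt (\<Sum>j=R..<m. d j)
      + 2 * min (sqrt R * op_norm Z) (L2_set (case_prod c) ({..<n} \<times> {..<m}))"
    by (rule trailing_rows_bound_coordinates[where s = s and k = k and d = d,
          OF A k_rows k_cols split _ _ dec b op_norm_nonneg R])
      (use D(13,14) in \<open>simp_all add: s_def\<close>)
  finally show ?thesis by (simp only: tail frob_c)
qed

section \<open>The error of the truncated SVD and the conclusion\<close>

text \<open>The SVD behind the truncation itself diagonalises X^T X, so its discarded diagonal
  entries are singular values in the sense of \<open>singular_value\<close>. Hence the error is the
  same for every admissible truncation.\<close>

lemma frob_norm_truncated_svd_diff:
  assumes X: "X \<in> carrier_mat n m" and R: "R \<le> min n m" and tr: "is_truncated_svd R X XR"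
  shows "frob_norm (XR - X) = sqrt (\<Sum>j=R+1..min n m. (singular_value j X)\<^sup>2)"
proof -
  obtain U Up S Sp V Vp where svd: "is_block_svd R X U Up S Sp V Vp" and XR: "XR = U * S * V\<^sup>T"
    using tr unfolding is_truncated_svd_def by blast
  define Uh where "Uh = append_cols U Up"
  define Vh where "Vh = append_cols V Vp"
  define Sh where "Sh = four_block_mat S (0\<^sub>m R (m - R)) (0\<^sub>m (n - R) R) Sp"
  note D = block_svdD[OF svd X, folded Uh_def Vh_def Sh_def]
  define S0 where "S0 = four_block_mat S (0\<^sub>m R (m - R)) (0\<^sub>m (n - R) R) (0\<^sub>m (n - R) (m - R))"
  have S0: "S0 \<in> carrier_mat n m"
    by (intro carrier_matI) (use D(3) R in \<open>auto simp: S0_def\<close>)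
  \<comment> \<open>X^T X has \<open>m\<close> eigenvalues; those beyond the diagonal of
    \<open>Sh\<close> are 0.\<close>
  define d where "d i = (if i < min n m then (Sh $$ (i, i))\<^sup>2 else 0)" for i
  have dec: "d j \<le> d i" if "i \<le> j" "j < m" for i j
    using that D(13,14) by (auto simp: d_def intro!: power_mono)
  have diag: "Vh\<^sup>T * (X\<^sup>T * X) * Vh = mat m m (\<lambda>(i, j). if i = j then d i else 0)"
  proof -
    have cV: "Vh\<^sup>T * Vh = 1\<^sub>m m" using D(9,10) by (simp add: orthonormal_cols_def)
    have XV: "X * Vh = Uh * Sh"
      using D(7,9,11) by (subst D(15)) (simp add: assoc_mult_mat_dim cV)
    have "Vh\<^sup>T * (X\<^sup>T * X) * Vh = (X * Vh)\<^sup>T * (X * Vh)"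
      using X D(9) by (simp add: transpose_mult_dim assoc_mult_mat_dim)
    also have "\<dots> = Sh\<^sup>T * (Uh\<^sup>T * (Uh * Sh))"
      unfolding XV using D(7,11) by (simp add: transpose_mult_dim assoc_mult_mat_dim)
    also have "\<dots> = Sh\<^sup>T * Sh" using D(7,8,11) by (subst orthonormal_cols_cancel) auto
    also have "\<dots> = mat m m (\<lambda>(i, j). if i = j then d i else 0)"
    proof (rule eq_matI)
      fix i j assume "i < dim_row (mat m m (\<lambda>(i, j). if i = j then d i else 0))"
        "j < dim_col (mat m m (\<lambda>(i, j). if i = j then d i else 0))"
      hence ij: "i < m" "j < m" by auto
      have "(Sh\<^sup>T * Sh) $$ (i, j) = (\<Sum>l<n. Sh $$ (l, i) * Sh $$ (l, j))"
        using ij D(11) by (subst mult_mat_index) auto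
      also have "\<dots> = (\<Sum>l<n. if l = i then (if i = j then d i else 0) else 0)"
        using D(11,12) ij by (intro sum.cong) (auto simp: diagonal_mat_def d_def power2_eq_square)
      also have "\<dots> = (if i = j then d i else 0)" by (auto simp: d_def)
      finally show "(Sh\<^sup>T * Sh) $$ (i, j) = mat m m (\<lambda>(i, j). if i = j then d i else 0) $$ (i, j)"
        using ij by simp
    qed (use D(11) in auto)
    finally show ?thesis .
  qed
  \<comment> \<open>Zeroing the trailing block writes the truncation with the same orthogonal
    factors as \<open>X\<close>, so that they cancel from the norm of the difference.\<close>
  have XR': "XR = Uh * (S0 * Vh\<^sup>T)"
  proof -
    \<comment> \<open>\<open>append_cols\<close> is a block matrix with empty lower blocks;
      transposed, they become empty right blocks.\<close>
    have VhT: "Vh\<^sup>T = four_block_mat V\<^sup>T (0\<^sub>m R 0) Vp\<^sup>T (0\<^sub>m (m - R) 0)"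
      unfolding Vh_def append_cols_def
      by (subst transpose_four_block_mat[of _ m R _ "m - R" _ 0]) (use D(5,6) in auto)
    have "S0 * Vh\<^sup>T = four_block_mat (S * V\<^sup>T) (0\<^sub>m R 0) (0\<^sub>m (n - R) m) (0\<^sub>m (n - R) 0)"
      unfolding VhT S0_def
      by (subst mult_four_block_mat[of _ R R _ "m - R" _ "n - R" _ _ m _ 0]) (use D(3,5,6) in auto)
    also have "Uh * \<dots> = four_block_mat (U * (S * V\<^sup>T)) (0\<^sub>m n 0) (0\<^sub>m 0 m) (0\<^sub>m 0 0)"
      unfolding Uh_def append_cols_def
      by (subst mult_four_block_mat[of _ n R _ "n - R" _ 0 _ _ m _ 0]) (use D(1,2,3,5) in auto)
    also have "\<dots> = U * (S * V\<^sup>T)" by (rule eq_matI) (use D(1,3,5) in auto)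
    finally show ?thesis using D(1,3,5) by (simp add: XR assoc_mult_mat_dim)
  qed
  have "XR - X = Uh * ((S0 - Sh) * Vh\<^sup>T)"
  proof -
    have "XR - X = Uh * (S0 * Vh\<^sup>T) - Uh * (Sh * Vh\<^sup>T)"
      using D(7,9,11) by (subst D(15), subst XR') (simp add: assoc_mult_mat_dim)
    also have "\<dots> = Uh * (S0 * Vh\<^sup>T - Sh * Vh\<^sup>T)"
      by (rule mult_minus_distrib_mat[symmetric]) (use D(7,9,11) S0 in auto)
    also have "S0 * Vh\<^sup>T - Sh * Vh\<^sup>T = (S0 - Sh) * Vh\<^sup>T"
      by (rule minus_mult_distrib_mat[symmetric]) (use D(9,11) S0 in auto)
    finally show ?thesis .
  qed
  hence "frob_norm (XR - X) = frob_norm ((S0 - Sh) * Vh\<^sup>T)"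
    using D(7,8,11) by (simp add: frob_norm_orthonormal_left)
  also have "\<dots> = frob_norm (S0 - Sh)"
    using orthonormal_cols_transpose[OF D(10,9)] D(9,11)
    by (intro frob_norm_orthonormal_right[of _ m]) auto
  also have "\<dots> = sqrt (\<Sum>i<n. \<Sum>j<m. if j = i then (if R \<le> i then d i else 0) else 0)"
  proof -
    have "((S0 - Sh) $$ (i, j))\<^sup>2 = (if j = i then (if R \<le> i then d i else 0) else 0)"
      if ij: "i < n" "j < m" for i j
    proof (cases "i = j")
      case True
      thus ?thesis using ij D(3,4) R by (auto simp: S0_def Sh_def d_def)
    next
      case False
      have "Sh $$ (i, j) = 0" using False D(11,12) ij by (auto simp: diagonal_mat_def)
      moreover have "S0 $$ (i, j) = (if i < R \<and> j < R then Sh $$ (i, j) else 0)"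
        using ij D(3,4) R by (auto simp: S0_def Sh_def)
      ultimately show ?thesis using False ij D(11) S0 by simp
    qed
    thus ?thesis unfolding frob_norm_def using D(11) S0
      by (intro arg_cong[of _ _ sqrt] sum.cong) auto
  qed
  also have "(\<Sum>i<n. \<Sum>j<m. if j = i then (if R \<le> i then d i else 0) else 0)
      = (\<Sum>i<n. if i \<in> {R..<min n m} then d i else 0)"
    by (intro sum.cong) auto
  also have "\<dots> = (\<Sum>i\<in>{..<n} \<inter> {R..<min n m}. d i)" by (rule sum.inter_restrict[symmetric]) simp
  also have "{..<n} \<inter> {R..<min n m} = {R..<min n m}" by auto
  finally show ?thesis by (simp only: sum_squares_singular_values[OF X D(9,10) diag dec])
qed

theorem lemma15:
  fixes X Z Y U Up S Sp V Vp :: "real mat" and n m R :: nat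
  assumes X: "X \<in> carrier_mat n m" and Z: "Z \<in> carrier_mat n m" and Y: "Y = X + Z"
    and R: "1 \<le> R" "R \<le> min n m"
    and svd: "is_block_svd R Y U Up S Sp V Vp"
  shows "frob_norm (col_proj Up * X)
           \<le> 3 * sqrt (\<Sum>j = R + 1..min n m. (singular_value j X)\<^sup>2)
             + 2 * min (sqrt (real R) * op_norm Z) (frob_norm Z)
         \<and> (\<forall>XR. is_truncated_svd R X XR \<longrightarrow>
             3 * sqrt (\<Sum>j = R + 1..min n m. (singular_value j X)\<^sup>2)
               + 2 * min (sqrt (real R) * op_norm Z) (frob_norm Z)
             = 3 * frob_norm (XR - X) + 2 * min (sqrt (real R) * op_norm Z) (frob_norm Z))"
proof (intro conjI allI impI)
  \<comment> \<open>Nonnegativity of the tail lets the coefficient 2 be raised to 3.\<close>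
  have "0 \<le> sqrt (\<Sum>j = R + 1..min n m. (singular_value j X)\<^sup>2)" by (simp add: sum_nonneg)
  moreover have "frob_norm (col_proj Up * X)
      \<le> 2 * sqrt (\<Sum>j = R + 1..min n m. (singular_value j X)\<^sup>2)
        + 2 * min (sqrt (real R) * op_norm Z) (frob_norm Z)"
    using frob_norm_col_proj_trailing_le[OF X Z R(2)] svd Y by blast
  ultimately show "frob_norm (col_proj Up * X)
      \<le> 3 * sqrt (\<Sum>j = R + 1..min n m. (singular_value j X)\<^sup>2)
        + 2 * min (sqrt (real R) * op_norm Z) (frob_norm Z)"
    by linarith
qed (simp only: frob_norm_truncated_svd_diff[OF X R(2)])

end
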